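(* For every composite integer $k$ that is not a power of two there exists a simple nested fractal $\mathcal{K}^{\langle 0\rangle}$ in $\mathbb{R}^2$ with exactly $k$ essential fixed points such that the corresponding unbounded simple nested fractal $\mathcal{K}^{\langle\infty\rangle}$ does not have the good labelling property (GLP).
   Context: Simple nested fractal (SNF). Let $\Psi_i:\mathbb{R}^2\to\mathbb{R}^2$, $\Psi_i(x)=x/L+\nu_i$, $i=1,\dots,N$, with $L>1$, $\nu_i\in\mathbb{R}^2$, and one of the $\nu_i$ equal to $0$. $\mathcal{K}^{\langle 0\rangle}$ is the unique nonempty compact set with $\mathcal{K}^{\langle 0\rangle}=\bigcup_{i=1}^N\Psi_i(\mathcal{K}^{\langle 0\rangle})$. Let $F$ be the set of fixed points of the $\Psi_i$. A point $x\in F$ is an essential fixed point if there are another fixed point $y\in F$ and two different maps $\Psi_i,\Psi_j$ with $\Psi_i(x)=\Psi_j(y)$. $V_0^{\langle 0\rangle}$ is the set of essential fixed points and $k=\#V_0^{\langle 0\rangle}$. $\mathcal{K}^{\langle 0\rangle}$ is an SNF if: (1) $k\ge 2$; (2) (Open Set Condition) there is an open $U\subset\mathbb{R}^2$ with $\Psi_i(U)\cap\Psi_j(U)=\emptyset$ for $i\ne j$ and $\bigcup_i\Psi_i(U)\subseteq U$; (3) (Nesting) $\Psi_i(\mathcal{K}^{\langle 0\rangle})\cap\Psi_j(\mathcal{K}^{\langle 0\rangle})=\Psi_i(V_0^{\langle 0\rangle})\cap\Psi_j(V_0^{\langle 0\rangle})$ for $i\neq j$; (4) (Symmetry) for $x,y\in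 V_0^{\langle 0\rangle}$ let $S_{x,y}$ be the reflection in the line perpendicularly bisecting $[x,y]$; for all $i\in\{1,\dots,N\}$ and all $x,y\in V_0^{\langle 0\rangle}$ there is $j\in\{1,\dots,N\}$ with $S_{x,y}(\Psi_i(V_0^{\langle 0\rangle}))=\Psi_j(V_0^{\langle 0\rangle})$; (5) (Connectivity) the graph on $V_{-1}^{\langle 0\rangle}=\bigcup_i\Psi_i(V_0^{\langle 0\rangle})$ in which $x,y$ are joined iff $x,y\in\Psi_i(\mathcal{K}^{\langle 0\rangle})$ for some $i$ is connected. For $k\ge 3$ it is known that $V_0^{\langle 0\rangle}$ is the vertex set of a regular $k$-gon. Complexes. $\mathcal{K}^{\langle M\rangle}=L^M\mathcal{K}^{\langle 0\rangle}$ and $\mathcal{K}^{\langle\infty\rangle}=\bigcup_{M\ge 0}\mathcal{K}^{\langle M\rangle}$ (the unbounded SNF). A $0$-complex is a set $\Delta_0=\mathcal{K}^{\langle 0\rangle}+\nu_{\Delta_0}\subset\mathcal{K}^{\langle\infty\rangle}$ with $\nu_{\Delta_0}=\sum_{j=1}^{J}L^j\nu_{i_j}$, $J\ge 1$, $\nu_{i_j}\in\{\nu_1,\dots,\nu_N\}$; its vertex set is $V(\Delta_0)=V_0^{\langle 0\rangle}+\nu_{\Delta_0}$. $V_0^{\langle\infty\rangle}$ is the set of vertices of all $0$-complexes. GLP. Let $\mathcal{A}$ be a set of $k$ labels, and let $\mathcal{R}_0$ be the set of the $k$ rotations around the barycenter of $\mathcal{K}^{\langle 0\rangle}$ mapping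 $V_0^{\langle 0\rangle}$ onto itself. $\mathcal{K}^{\langle\infty\rangle}$ has the GLP if there is $\ell:V_0^{\langle\infty\rangle}\to\mathcal{A}$ whose restriction to $V_0^{\langle 0\rangle}$ is a bijection onto $\mathcal{A}$ and such that for every $0$-complex $\Delta_0=\mathcal{K}^{\langle 0\rangle}+\nu_{\Delta_0}$ there is $R_{\Delta_0}\in\mathcal{R}_0$ with $\ell(v)=\ell(R_{\Delta_0}(v-\nu_{\Delta_0}))$ for all $v\in V(\Delta_0)$. (By self-similarity the analogous property for complexes of any other scale $L^M$, $M\in\mathbb{Z}$, is equivalent.) *)

theory Defs
  imports "HOL-Analysis.Analysis" "HOL-Computational_Algebra.Primes"
begin

text \<open>An iterated function system is given by the number \<open>N\<close> of its maps, the scaling factor \<open>L\<close>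
  and the translation vectors \<open>\<nu> i\<close>, of which only those with \<open>i \<in> {1..N}\<close> matter.\<close>

definition Psi :: "real \<Rightarrow> (nat \<Rightarrow> 'a::euclidean_space) \<Rightarrow> nat \<Rightarrow> 'a \<Rightarrow> 'a" where
  "Psi L \<nu> i x = x /\<^sub>R L + \<nu> i"

text \<open>For \<open>L > 1\<close> and \<open>N \<ge> 1\<close> the set below exists and is unique by Hutchinson's theorem;
  all uses are under these conditions.\<close>

definition attractor :: "nat \<Rightarrow> real \<Rightarrow> (nat \<Rightarrow> 'a::euclidean_space) \<Rightarrow> 'a set" where
  "attractor N L \<nu> = (THE K. compact K \<and> K \<noteq> {} \<and> K = (\<Union>i\<in>{1..N}. Psi L \<nu> i ` K))"

definition fixed_points :: "nat \<Rightarrow> real \<Rightarrow> (nat \<Rightarrow> 'a::euclidean_space) \<Rightarrow> 'a set" where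
  "fixed_points N L \<nu> = {x. \<exists>i\<in>{1..N}. Psi L \<nu> i x = x}"

definition essential_fixed_points :: "nat \<Rightarrow> real \<Rightarrow> (nat \<Rightarrow> 'a::euclidean_space) \<Rightarrow> 'a set" where
  "essential_fixed_points N L \<nu> =
     {x \<in> fixed_points N L \<nu>. \<exists>y\<in>fixed_points N L \<nu>. y \<noteq> x \<and>
        (\<exists>i\<in>{1..N}. \<exists>j\<in>{1..N}. Psi L \<nu> i \<noteq> Psi L \<nu> j \<and> Psi L \<nu> i x = Psi L \<nu> j y)}"

text \<open>The orthogonal reflection in the hyperplane (in the plane: the line) perpendicularly
  bisecting the segment between two distinct points \<open>x\<close> and \<open>y\<close>.\<close>

definition bisector_reflection :: "'a::euclidean_space \<Rightarrow> 'a \<Rightarrow> 'a \<Rightarrow> 'a" where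
  "bisector_reflection x y z =
     z - (2 * ((z - midpoint x y) \<bullet> (y - x)) / ((y - x) \<bullet> (y - x))) *\<^sub>R (y - x)"

definition open_set_condition :: "nat \<Rightarrow> real \<Rightarrow> (nat \<Rightarrow> 'a::euclidean_space) \<Rightarrow> bool" where
  "open_set_condition N L \<nu> \<longleftrightarrow>
     (\<exists>U. open U \<and> U \<noteq> {} \<and>
        (\<forall>i\<in>{1..N}. \<forall>j\<in>{1..N}. i \<noteq> j \<longrightarrow> Psi L \<nu> i ` U \<inter> Psi L \<nu> j ` U = {}) \<and>
        (\<Union>i\<in>{1..N}. Psi L \<nu> i ` U) \<subseteq> U)"

definition nesting :: "nat \<Rightarrow> real \<Rightarrow> (nat \<Rightarrow> 'a::euclidean_space) \<Rightarrow> bool" where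
  "nesting N L \<nu> \<longleftrightarrow>
     (let K = attractor N L \<nu>; V0 = essential_fixed_points N L \<nu> in
      \<forall>i\<in>{1..N}. \<forall>j\<in>{1..N}. i \<noteq> j \<longrightarrow>
        Psi L \<nu> i ` K \<inter> Psi L \<nu> j ` K = Psi L \<nu> i ` V0 \<inter> Psi L \<nu> j ` V0)"

definition symmetry :: "nat \<Rightarrow> real \<Rightarrow> (nat \<Rightarrow> 'a::euclidean_space) \<Rightarrow> bool" where
  "symmetry N L \<nu> \<longleftrightarrow>
     (let V0 = essential_fixed_points N L \<nu> in
      \<forall>i\<in>{1..N}. \<forall>x\<in>V0. \<forall>y\<in>V0. x \<noteq> y \<longrightarrow>
        (\<exists>j\<in>{1..N}. bisector_reflection x y ` (Psi L \<nu> i ` V0) = Psi L \<nu> j ` V0))"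

definition connectivity :: "nat \<Rightarrow> real \<Rightarrow> (nat \<Rightarrow> 'a::euclidean_space) \<Rightarrow> bool" where
  "connectivity N L \<nu> \<longleftrightarrow>
     (let K = attractor N L \<nu>;
          V = (\<Union>i\<in>{1..N}. Psi L \<nu> i ` essential_fixed_points N L \<nu>);
          E = {(x, y) \<in> V \<times> V. \<exists>i\<in>{1..N}. x \<in> Psi L \<nu> i ` K \<and> y \<in> Psi L \<nu> i ` K}
      in \<forall>x\<in>V. \<forall>y\<in>V. (x, y) \<in> E\<^sup>*)"

definition simple_nested_fractal :: "nat \<Rightarrow> real \<Rightarrow> (nat \<Rightarrow> real ^ 2) \<Rightarrow> bool" where
  "simple_nested_fractal N L \<nu> \<longleftrightarrow>
     L > 1 \<and> (\<exists>i\<in>{1..N}. \<nu> i = 0) \<and>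
     card (essential_fixed_points N L \<nu>) \<ge> 2 \<and>
     open_set_condition N L \<nu> \<and> nesting N L \<nu> \<and> symmetry N L \<nu> \<and> connectivity N L \<nu>"

definition unbounded_fractal :: "nat \<Rightarrow> real \<Rightarrow> (nat \<Rightarrow> 'a::euclidean_space) \<Rightarrow> 'a set" where
  "unbounded_fractal N L \<nu> = (\<Union>M::nat. (\<lambda>x. L ^ M *\<^sub>R x) ` attractor N L \<nu>)"

text \<open>A 0-complex is a translate \<open>d + K\<close> of the attractor \<open>K\<close>, and since \<open>K\<close> is nonempty and
  compact, it determines the translation vector \<open>d\<close>. So 0-complexes are represented by
  their translation vectors.\<close>

definition zero_complexes :: "nat \<Rightarrow> real \<Rightarrow> (nat \<Rightarrow> 'a::euclidean_space) \<Rightarrow> 'a set" where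
  "zero_complexes N L \<nu> =
     {d. (\<exists>J\<ge>1. \<exists>i. (\<forall>j\<in>{1..J}. i j \<in> {1..N}) \<and> d = (\<Sum>j=1..J. L ^ j *\<^sub>R \<nu> (i j))) \<and>
         (\<lambda>x. x + d) ` attractor N L \<nu> \<subseteq> unbounded_fractal N L \<nu>}"

definition complex_vertices :: "nat \<Rightarrow> real \<Rightarrow> (nat \<Rightarrow> 'a::euclidean_space) \<Rightarrow> 'a \<Rightarrow> 'a set" where
  "complex_vertices N L \<nu> d = (\<lambda>x. x + d) ` essential_fixed_points N L \<nu>"

definition all_vertices :: "nat \<Rightarrow> real \<Rightarrow> (nat \<Rightarrow> 'a::euclidean_space) \<Rightarrow> 'a set" where
  "all_vertices N L \<nu> = (\<Union>d\<in>zero_complexes N L \<nu>. complex_vertices N L \<nu> d)"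

text \<open>The barycenter of a simple nested fractal is taken to be that of its finite set of
  essential fixed points: the fractal is invariant under the symmetries of this set, so
  its center of mass is the center of these symmetries.\<close>

definition barycenter :: "nat \<Rightarrow> real \<Rightarrow> (nat \<Rightarrow> 'a::euclidean_space) \<Rightarrow> 'a" where
  "barycenter N L \<nu> =
     (\<Sum>v\<in>essential_fixed_points N L \<nu>. v) /\<^sub>R real (card (essential_fixed_points N L \<nu>))"

definition rotation_about :: "real ^ 2 \<Rightarrow> (real ^ 2 \<Rightarrow> real ^ 2) \<Rightarrow> bool" where
  "rotation_about c R \<longleftrightarrow>
     (\<exists>A :: real ^ 2 ^ 2. rotation_matrix A \<and> (\<forall>x. R x = c + A *v (x - c)))"

definition vertex_rotations :: "nat \<Rightarrow> real \<Rightarrow> (nat \<Rightarrow> real ^ 2) \<Rightarrow> (real ^ 2 \<Rightarrow> real ^ 2) set" where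
  "vertex_rotations N L \<nu> =
     {R. rotation_about (barycenter N L \<nu>) R \<and>
         R ` essential_fixed_points N L \<nu> = essential_fixed_points N L \<nu>}"

text \<open>The good labelling property. The set of labels can be any set with as many elements as
  there are essential fixed points.\<close>

definition GLP :: "nat \<Rightarrow> real \<Rightarrow> (nat \<Rightarrow> real ^ 2) \<Rightarrow> bool" where
  "GLP N L \<nu> \<longleftrightarrow>
     (let V0 = essential_fixed_points N L \<nu>; labels = {1..card V0} in
      \<exists>l :: real ^ 2 \<Rightarrow> nat.
        l \<in> all_vertices N L \<nu> \<rightarrow> labels \<and> bij_betw l V0 labels \<and>
        (\<forall>d\<in>zero_complexes N L \<nu>. \<exists>R\<in>vertex_rotations N L \<nu>.
           \<forall>v\<in>complex_vertices N L \<nu> d. l v = l (R (v - d))))"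

end

theory Submission
  imports Defs
begin

text \<open>A set of cells in which two cells are either disjoint or share one vertex, which is
  invariant under the dihedral group and which links the \<open>k\<close> corners, generates a simple nested
  fractal. Let \<open>p\<close> be an odd prime factor of \<open>k\<close>. A good labelling attaches a rotation \<open>\<zeta>\<close>,
  a \<open>k\<close>-th root of unity, to each cell. If two cells touch, the vertex \<open>y\<close> of the one being the
  vertex \<open>x\<close> of the other, then the quotient of their rotations is \<open>x / y\<close>. In a ring of \<open>p\<close>
  cells placed along a regular \<open>p\<close>-gon all these quotients are the same, because rotating by
  \<open>2 \<pi> / p\<close> preserves the regular \<open>k\<close>-gon. So \<open>(x / y) ^ p = 1\<close>, which is false when \<open>x\<close> and
  \<open>y\<close> are vertices at maximal distance. Such rings are inserted into long chains of cells
  joining the corners to the symmetry axes; for \<open>p < k\<close> the ring fits without meeting its images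
  under the symmetries once the chains are long enough.\<close>

section \<open>Attractors\<close>

text \<open>Both exclusions on \<open>k\<close> come from \<open>(x / y) ^ p \<noteq> 1\<close>. For
  even \<open>k\<close> the vertices are opposite and \<open>x / y\<close> is -1, so
  \<open>p\<close> must be odd; for odd \<open>k\<close> the quotient is a primitive
  \<open>k\<close>-th root of unity, so \<open>p\<close> must be a proper divisor. Maximal distance
  is forced because the attractor is controlled only through balls that contain it: cells that touch
  along a diameter of \<open>V\<close> meet in a single point by the parallelogram law. The
  direction \<open>t\<close> of the chains is squeezed. Each step has to leave one wall of a chamber
  and approach the other by more than 1, so that just the two end cells lie on walls and the others
  miss their mirror images; and \<open>t\<close> must not advance along the second wall, so that the
  far end stays inside the polygon. This holds if the angle \<open>A\<close> between
  \<open>t\<close> and the vertical lies between \<open>pi / k\<close> and \<open>pi / 4\<close>.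
  The ring has a fixed size while \<open>R\<close> grows linearly with the number of steps. After
  division by \<open>R\<close> the ring shrinks to a point inside the chamber, and containment
  becomes an open condition on limit points.\<close>

lemma invariant_set_subset:
  fixes A B :: "'a::euclidean_space set"
  assumes L: "L > 1"
    and A: "compact A" "A \<noteq> {}" "A = (\<Union>i\<in>{1..N}. Psi L \<nu> i ` A)"
    and B: "compact B" "B \<noteq> {}" "B = (\<Union>i\<in>{1..N}. Psi L \<nu> i ` B)"
  shows "A \<subseteq> B"
proof -
  \<comment> \<open>A point of \<open>A\<close> at maximal distance from \<open>B\<close> is the
    image of some \<open>a'\<close> in \<open>A\<close>. The contraction divides distances by
    \<open>L\<close>, so the maximum is at most itself divided by \<open>L\<close>, hence 0.\<close>
  have "continuous_on A (\<lambda>x. infdist x B)"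
    by (intro continuous_intros)
  then obtain a where a: "a \<in> A" "\<And>x. x \<in> A \<Longrightarrow> infdist x B \<le> infdist a B"
    using continuous_attains_sup[OF A(1,2)] by blast
  obtain i a' where i: "i \<in> {1..N}" "a' \<in> A" "a = Psi L \<nu> i a'"
    using a(1) A(3) by blast
  obtain b' where b': "b' \<in> B" "infdist a' B = dist a' b'"
    using infdist_attains_inf[of B a'] B(1,2) compact_imp_closed by blast
  have "Psi L \<nu> i b' \<in> B"
    using B(3) i(1) b'(1) by blast
  then have "infdist a B \<le> dist (Psi L \<nu> i a') (Psi L \<nu> i b')"
    unfolding i(3) by (rule infdist_le)
  also have "\<dots> = dist a' b' / L"
    using L by (simp add: Psi_def dist_norm divide_inverse mult.commute flip: scaleR_diff_right)
  also have "\<dots> \<le> infdist a B / L"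
    using a(2)[OF i(2)] b'(2) L by (simp add: divide_right_mono)
  finally have "infdist a B * (L - 1) \<le> 0"
    using L by (simp add: field_simps)
  then have "infdist a B \<le> 0"
    using L by (simp add: mult_le_0_iff)
  then have "infdist x B = 0" if "x \<in> A" for x
    using a(2)[OF that] infdist_nonneg[of x B] by linarith
  then show ?thesis
    using in_closed_iff_infdist_zero[of B] B(1,2) compact_imp_closed by blast
qed

lemma attractor_eqI:
  fixes K :: "'a::euclidean_space set"
  assumes "L > 1" "compact K" "K \<noteq> {}" "K = (\<Union>i\<in>{1..N}. Psi L \<nu> i ` K)"
  shows "attractor N L \<nu> = K"
  unfolding attractor_def
proof (rule the_equality)
  show "K' = K" if "compact K' \<and> K' \<noteq> {} \<and> K' = (\<Union>i\<in>{1..N}. Psi L \<nu> i ` K')" for K'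
    using invariant_set_subset[of L K \<nu> N K'] invariant_set_subset[of L K' \<nu> N K] assms that by blast
qed (use assms in blast)

text \<open>The greatest post-fixed point inside \<open>X\<close> of the Hutchinson operator is closed, because the
  closure of a post-fixed point is one.\<close>

lemma attractor_within:
  fixes X :: "'a::euclidean_space set"
  assumes L: "L > 1" and X: "compact X" "X \<noteq> {}"
    and sub: "\<And>i. i \<in> {1..N} \<Longrightarrow> Psi L \<nu> i ` X \<subseteq> X"
    and N: "N \<ge> 1" "fixed_points N L \<nu> \<subseteq> X"
  shows "compact (attractor N L \<nu>)" "attractor N L \<nu> \<subseteq> X" "fixed_points N L \<nu> \<subseteq> attractor N L \<nu>"
    "attractor N L \<nu> = (\<Union>i\<in>{1..N}. Psi L \<nu> i ` attractor N L \<nu>)"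
proof -
  define H where "H A = (\<Union>i\<in>{1..N}. Psi L \<nu> i ` A)" for A
  define K where "K = \<Union>{A. A \<subseteq> X \<and> A \<subseteq> H A}"
  have cont: "continuous_on A (Psi L \<nu> i)" for A i
    unfolding Psi_def by (intro continuous_intros)
  have mono: "H A \<subseteq> H B" if "A \<subseteq> B" for A B
    using that by (auto simp: H_def)
  have max: "A \<subseteq> K" if "A \<subseteq> X" "A \<subseteq> H A" for A
    unfolding K_def using that by (intro Sup_upper CollectI conjI)
  have KX: "K \<subseteq> X"
    unfolding K_def by (rule Sup_least) simp
  have "A \<subseteq> H K" if "A \<subseteq> X" "A \<subseteq> H A" for A
    using mono[OF max[OF that]] that(2) by (rule subset_trans[rotated])
  then have KH: "K \<subseteq> H K"
    by (subst K_def) (rule Sup_least, simp)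
  have HX: "H A \<subseteq> X" if "A \<subseteq> X" for A
    unfolding H_def using image_mono[OF that] sub by (intro UN_least) (rule subset_trans)
  have fixK: "K = H K"
    using KH max[of "H K"] HX[OF KX] mono[OF KH] by blast
  have clX: "closure K \<subseteq> X"
    using KX X(1) compact_imp_closed closure_minimal by blast
  then have "compact (closure K)"
    using X(1) compact_closure bounded_subset compact_imp_bounded KX by blast
  then have "compact (H (closure K))"
    unfolding H_def by (intro compact_UN compact_continuous_image cont) auto
  moreover have "K \<subseteq> H (closure K)"
    using KH mono[OF closure_subset] by blast
  ultimately have "closure K \<subseteq> H (closure K)"
    by (meson closure_minimal compact_imp_closed)
  then have "closure K = K"
    using max[OF clX] closure_subset by blast
  then have cK: "compact K"
    using \<open>compact (closure K)\<close> by simp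
  have fp: "fixed_points N L \<nu> \<subseteq> K"
  proof (rule max[OF N(2)])
    show "fixed_points N L \<nu> \<subseteq> H (fixed_points N L \<nu>)"
      by (force simp: fixed_points_def H_def)
  qed
  \<comment> \<open>The solution of \<open>x / L + \<nu> 1 = x\<close>. It makes \<open>K\<close>
    nonempty, as \<open>attractor_eqI\<close> demands.\<close>
  have "Psi L \<nu> 1 ((L / (L - 1)) *\<^sub>R \<nu> 1) = (L / (L - 1)) *\<^sub>R \<nu> 1"
  proof -
    have "inverse L * (L / (L - 1)) + 1 = L / (L - 1)"
      using L by (simp add: field_simps)
    then show ?thesis
      unfolding Psi_def by (metis scaleR_add_left scaleR_one scaleR_scaleR)
  qed
  then have "fixed_points N L \<nu> \<noteq> {}"
    using N(1) by (force simp: fixed_points_def)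
  then have "attractor N L \<nu> = K"
    using attractor_eqI[OF L cK] fp fixK unfolding H_def by blast
  then show "compact (attractor N L \<nu>)" "attractor N L \<nu> \<subseteq> X" "fixed_points N L \<nu> \<subseteq> attractor N L \<nu>"
    "attractor N L \<nu> = (\<Union>i\<in>{1..N}. Psi L \<nu> i ` attractor N L \<nu>)"
    using cK KX fp fixK unfolding H_def by auto
qed

section \<open>Simple nested fractals from patterns of cells\<close>

text \<open>The vertex \<open>w\<close> of the cell at \<open>d\<close> coincides with the vertex
  \<open>v\<close> of the cell at \<open>d'\<close>. In use \<open>\<tau>\<close> is the diameter of
  \<open>V\<close>, and touching along a diameter rules out further common points.\<close>

definition touching :: "real \<Rightarrow> 'a::real_normed_vector set \<Rightarrow> 'a \<Rightarrow> 'a \<Rightarrow> bool" where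
  "touching \<tau> V d d' \<longleftrightarrow> (\<exists>v\<in>V. \<exists>w\<in>V. d - d' = v - w \<and> norm (v - w) = \<tau>)"

text \<open>The elements \<open>d \<in> D\<close> are the positions of the cells \<open>d + K\<close> whose union is \<open>(R + 1) K\<close>. All
  that is used of the attractor \<open>K\<close> is that it lies in the unit ball and in the balls of radius
  \<open>\<tau>\<close> about the points of \<open>V\<close>; cells at such positions are disjoint or share a single vertex.\<close>

locale cell_pattern =
  fixes V D :: "'a::euclidean_space set" and \<tau> R :: real
  assumes finite_V: "finite V" and card_V: "card V \<ge> 2" and finite_D: "finite D"
    and R_pos: "R > 0" and \<tau>_gt_1: "\<tau> > 1"
    and norm_V: "v \<in> V \<Longrightarrow> norm v = 1"
    and dist_V: "v \<in> V \<Longrightarrow> w \<in> V \<Longrightarrow> norm (v - w) \<le> \<tau>"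
    and norm_D: "d \<in> D \<Longrightarrow> norm d \<le> R"
    and dist_D: "d \<in> D \<Longrightarrow> v \<in> V \<Longrightarrow> norm (d - R *\<^sub>R v) \<le> \<tau> * R"
    and corner: "v \<in> V \<Longrightarrow> R *\<^sub>R v \<in> D"
    and separated: "d \<in> D \<Longrightarrow> d' \<in> D \<Longrightarrow> d \<noteq> d' \<Longrightarrow> touching \<tau> V d d' \<or> norm (d - d') > 2"
    and reflect_V: "x \<in> V \<Longrightarrow> y \<in> V \<Longrightarrow> x \<noteq> y \<Longrightarrow> bisector_reflection x y ` V = V"
    and reflect_D: "x \<in> V \<Longrightarrow> y \<in> V \<Longrightarrow> x \<noteq> y \<Longrightarrow> d \<in> D \<Longrightarrow> bisector_reflection x y d \<in> D"
    and linked: "d \<in> D \<Longrightarrow> d' \<in> D \<Longrightarrow> (d, d') \<in> {(d, d') \<in> D \<times> D. touching \<tau> V d d'}\<^sup>*"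
begin

definition cell :: "'a set" where
  "cell = {x. norm x \<le> 1 \<and> (\<forall>v\<in>V. norm (x - v) \<le> \<tau>)}"

lemma V_subset_cell: "V \<subseteq> cell"
  using norm_V dist_V by (auto simp: cell_def)

text \<open>A common point differs from the shared vertex by some \<open>e\<close>, and both
  \<open>v - w + e\<close> and \<open>w - v + e\<close> have norm at most
  \<open>\<tau> = norm (v - w)\<close>. By the parallelogram law \<open>e = 0\<close>.\<close>

lemma cells_meet_in_vertex:
  assumes "p \<in> cell" "q \<in> cell" "d \<in> D" "d' \<in> D" "d \<noteq> d'" "p + d = q + d'"
  shows "p \<in> V \<and> q \<in> V \<and> norm (p - q) = \<tau>"
proof -
  have pq: "d - d' = q - p"
    using assms(6) by (simp add: algebra_simps)
  have "norm (q - p) \<le> norm q + norm p"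
    by (rule norm_triangle_ineq4)
  then have "\<not> norm (d - d') > 2"
    using assms(1,2) by (simp add: pq cell_def)
  then obtain v w where vw: "v \<in> V" "w \<in> V" "q - p = v - w" "norm (v - w) = \<tau>"
    using separated[OF assms(3-5)] by (auto simp: touching_def pq)
  define e where "e = q - v"
  have pe: "p = w + e" "q = v + e"
    using vw(3) by (simp_all add: e_def algebra_simps)
  have "norm (v - w + e) \<le> \<tau>" "norm (w - v + e) \<le> \<tau>"
    using assms(1,2) vw(1,2) by (auto simp: cell_def pe algebra_simps)
  then have "norm (v - w + e)^2 \<le> \<tau>^2" "norm (w - v + e)^2 \<le> \<tau>^2"
    by (simp_all add: power_mono)
  moreover have "norm (v - w + e)^2 + norm (w - v + e)^2 = 2 * norm (v - w)^2 + 2 * norm e^2"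
    by (simp add: power2_norm_eq_inner inner_simps inner_commute)
  ultimately have "norm e^2 \<le> 0"
    unfolding vw(4) by linarith
  then have "e = 0"
    by simp
  then show ?thesis
    using vw by (simp add: pe norm_minus_commute)
qed

text \<open>Two corners are distinct and linked, so the path from one to the other has a first
  step.\<close>

lemma ex_touching:
  obtains v w d d' where "v \<in> V" "w \<in> V" "norm (v - w) = \<tau>" "d \<in> D" "d' \<in> D" "d + v = d' + w"
proof -
  obtain v w where vw: "v \<in> V" "w \<in> V" "v \<noteq> w"
    using card_V by (metis card_le_Suc0_iff_eq finite_V not_less_eq_eq numeral_2_eq_2)
  have ne: "R *\<^sub>R v \<noteq> R *\<^sub>R w"
    using vw(3) R_pos by simp
  have "(R *\<^sub>R v, R *\<^sub>R w) \<in> {(d, d') \<in> D \<times> D. touching \<tau> V d d'}\<^sup>*"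
    by (intro linked corner vw)
  then obtain d where d: "d \<in> D" "touching \<tau> V (R *\<^sub>R v) d"
    using ne by (cases rule: converse_rtranclE) auto
  then obtain v' w' where "v' \<in> V" "w' \<in> V" "norm (v' - w') = \<tau>" "R *\<^sub>R v - d = v' - w'"
    by (auto simp: touching_def)
  with that[of w' v' "R *\<^sub>R v" d] show thesis
    using \<open>d \<in> D\<close> corner[OF vw(1)] by (simp add: algebra_simps norm_minus_commute)
qed

text \<open>Points of \<open>V\<close> have norm 1, so the bisecting hyperplane contains 0.\<close>

lemma bisector_reflection_linear:
  assumes "x \<in> V" "y \<in> V"
  shows "bisector_reflection x y z = z - (2 * (z \<bullet> (y - x)) / ((y - x) \<bullet> (y - x))) *\<^sub>R (y - x)"
proof -
  have "midpoint x y \<bullet> (y - x) = (norm y^2 - norm x^2) / 2"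
    by (simp add: midpoint_def inner_simps power2_norm_eq_inner inner_commute)
  also have "\<dots> = 0"
    using assms norm_V by simp
  finally show ?thesis
    by (simp add: bisector_reflection_def inner_diff_left)
qed

lemma bisector_reflection_add:
  assumes "x \<in> V" "y \<in> V"
  shows "bisector_reflection x y (z + z') = bisector_reflection x y z + bisector_reflection x y z'"
    "bisector_reflection x y (c *\<^sub>R z) = c *\<^sub>R bisector_reflection x y z"
    "norm (bisector_reflection x y z) = norm z"
proof -
  show "bisector_reflection x y (z + z') = bisector_reflection x y z + bisector_reflection x y z'"
    by (simp add: bisector_reflection_linear[OF assms] inner_add_left add_divide_distrib
        ring_distribs scaleR_add_left)
  show "bisector_reflection x y (c *\<^sub>R z) = c *\<^sub>R bisector_reflection x y z"
    by (simp add: bisector_reflection_linear[OF assms] algebra_simps)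
  show "norm (bisector_reflection x y z) = norm z"
  proof (cases "x = y")
    case False
    then have pos: "(y - x) \<bullet> (y - x) \<noteq> 0"
      by simp
    define u where "u = y - x"
    define c where "c = 2 * (z \<bullet> u) / (u \<bullet> u)"
    have c: "c * (u \<bullet> u) = 2 * (z \<bullet> u)"
      using pos by (simp add: c_def u_def)
    have "norm (z - c *\<^sub>R u)^2 = norm z^2 - 2 * c * (z \<bullet> u) + c * (c * (u \<bullet> u))"
      by (simp add: power2_norm_eq_inner inner_diff_left inner_diff_right inner_commute)
    also have "\<dots> = norm z^2"
      by (simp add: c)
    finally show ?thesis
      by (simp add: bisector_reflection_linear[OF assms] c_def u_def)
  qed (use assms bisector_reflection_linear in simp)
qed

lemma bisector_reflection_swap:
  assumes "x \<in> V" "y \<in> V" "x \<noteq> y"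
  shows "bisector_reflection x y x = y"
proof -
  have "2 * (x \<bullet> (y - x)) = - ((y - x) \<bullet> (y - x)) + norm y^2 - norm x^2"
    by (simp add: inner_simps power2_norm_eq_inner inner_commute)
  also have "\<dots> = - ((y - x) \<bullet> (y - x))"
    using assms norm_V by simp
  finally show ?thesis
    using assms by (simp add: bisector_reflection_linear)
qed

text \<open>The reflections act transitively on \<open>V\<close>, so one touching pair of cells provides one at
  every vertex.\<close>

lemma touching_at:
  assumes "v \<in> V"
  obtains w d d' where "w \<in> V" "w \<noteq> v" "d \<in> D" "d' \<in> D" "d \<noteq> d'" "d + v = d' + w"
proof -
  obtain u w d d' where *: "u \<in> V" "w \<in> V" "norm (u - w) = \<tau>" "d \<in> D" "d' \<in> D" "d + u = d' + w"
    by (rule ex_touching)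
  have ne: "u \<noteq> w"
    using * \<tau>_gt_1 by auto
  show thesis
  proof (cases "u = v")
    case True
    then show thesis
      using that[of w d d'] * ne by (metis add_left_cancel)
  next
    case False
    let ?S = "bisector_reflection u v"
    have "norm (?S (u - w)) = norm (u - w)"
      by (rule bisector_reflection_add(3)[OF *(1) assms])
    moreover have "?S (u - w) = ?S u - ?S w"
      using bisector_reflection_add(1)[OF *(1) assms, of "u - w" w] by (simp add: algebra_simps)
    ultimately have "?S w \<noteq> v"
      using ne bisector_reflection_swap[OF *(1) assms False] by auto
    moreover have "?S d + v = ?S d' + ?S w"
      using arg_cong[OF *(6), of ?S] bisector_reflection_add(1)[OF *(1) assms]
        bisector_reflection_swap[OF *(1) assms False] by simp
    moreover have "?S w \<in> V"
      using reflect_V[OF *(1) assms False] *(2) by blast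
    ultimately show thesis
      using that[of "?S w" "?S d" "?S d'"] reflect_D[OF *(1) assms False] *(4,5)
      by (metis add_left_cancel)
  qed
qed

end

text \<open>The maps \<open>x \<mapsto> (x + d) / (R + 1)\<close> for \<open>d \<in> D\<close>, conjugated by the translation by \<open>- a\<close>, which
  makes the translation vector of the map with fixed point \<open>a\<close> vanish.\<close>

locale numbered_pattern = cell_pattern V D \<tau> R
  for V D :: "'a::euclidean_space set" and \<tau> R :: real +
  fixes a :: 'a and f :: "nat \<Rightarrow> 'a" and N :: nat
  assumes a_V: "a \<in> V" and f_bij: "bij_betw f {1..N} D"
begin

definition trans :: "nat \<Rightarrow> 'a" where
  "trans i = (f i - R *\<^sub>R a) /\<^sub>R (R + 1)"

abbreviation "\<psi> \<equiv> Psi (R + 1) trans"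
abbreviation "\<K> \<equiv> attractor N (R + 1) trans"
abbreviation "V\<^sub>0 \<equiv> essential_fixed_points N (R + 1) trans"

lemma f_D: "i \<in> {1..N} \<Longrightarrow> f i \<in> D"
  using f_bij bij_betwE by blast

lemma f_eq_iff: "i \<in> {1..N} \<Longrightarrow> j \<in> {1..N} \<Longrightarrow> f i = f j \<longleftrightarrow> i = j"
  using f_bij by (meson bij_betw_def inj_on_eq_iff)

lemma f_surj: "d \<in> D \<Longrightarrow> \<exists>i\<in>{1..N}. f i = d"
  using f_bij by (metis bij_betw_def imageE)

text \<open>In the coordinate \<open>z = x + a\<close> the maps become
  \<open>z \<mapsto> (z + f i) / (R + 1)\<close>, free of \<open>a\<close>; hence the recurring
  \<open>+ a\<close>.\<close>

lemma Psi_trans: "\<psi> i x + a = (x + a + f i) /\<^sub>R (R + 1)"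
proof -
  have "(R + 1) *\<^sub>R \<psi> i x = x + (f i - R *\<^sub>R a)"
    using R_pos by (simp add: Psi_def trans_def scaleR_add_right)
  then have "(R + 1) *\<^sub>R (\<psi> i x + a) = x + a + f i"
    by (simp add: scaleR_add_right algebra_simps)
  then have "(x + a + f i) /\<^sub>R (R + 1) = (inverse (R + 1) * (R + 1)) *\<^sub>R (\<psi> i x + a)"
    by (metis scaleR_scaleR)
  then show ?thesis
    using R_pos by simp
qed

lemma Psi_eq_iff: "\<psi> i x = \<psi> j y \<longleftrightarrow> x + f i = y + f j"
proof -
  have "\<psi> i x = \<psi> j y \<longleftrightarrow> \<psi> i x + a = \<psi> j y + a"
    by simp
  also have "\<dots> \<longleftrightarrow> x + a + f i = y + a + f j"
    using R_pos unfolding Psi_trans by simp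
  finally show ?thesis
    by (simp add: algebra_simps)
qed

lemma Psi_fun_eq_iff: "i \<in> {1..N} \<Longrightarrow> j \<in> {1..N} \<Longrightarrow> \<psi> i = \<psi> j \<longleftrightarrow> i = j"
  using Psi_eq_iff[of i 0 j 0] f_eq_iff by auto

lemma Psi_fixed_iff: "\<psi> i x = x \<longleftrightarrow> R *\<^sub>R (x + a) = f i"
proof -
  have "\<psi> i x = x \<longleftrightarrow> \<psi> i x + a = x + a"
    by simp
  also have "\<dots> \<longleftrightarrow> (R + 1) *\<^sub>R (\<psi> i x + a) = (R + 1) *\<^sub>R (x + a)"
    using R_pos by simp
  also have "\<dots> \<longleftrightarrow> x + a + f i = (R + 1) *\<^sub>R (x + a)"
    using R_pos unfolding Psi_trans by simp
  also have "\<dots> \<longleftrightarrow> R *\<^sub>R (x + a) = f i"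
    by (auto simp: algebra_simps)
  finally show ?thesis .
qed

abbreviation "X \<equiv> (\<lambda>x. x - a) ` cell"

lemma mem_X: "x \<in> X \<longleftrightarrow> x + a \<in> cell"
  by (metis (no_types, lifting) add_diff_cancel diff_add_cancel image_iff)

text \<open>\<open>\<psi> i x + a\<close> is the average of \<open>x + a\<close> and
  \<open>f i / R\<close> with weights \<open>1 : R\<close>, so it inherits the ball bounds that both
  satisfy. The bound is left in terms of \<open>x\<close> because it serves the closed balls of
  \<open>X\<close> as well as the open ones of the open set condition.\<close>

lemma Psi_bounds:
  assumes "i \<in> {1..N}"
  shows "norm (\<psi> i x + a) \<le> (norm (x + a) + R) / (R + 1)"
    "v \<in> V \<Longrightarrow> norm (\<psi> i x + a - v) \<le> (norm (x + a - v) + \<tau> * R) / (R + 1)"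
proof -
  have "norm (x + a + f i) \<le> norm (x + a) + R"
    using norm_triangle_ineq[of "x + a" "f i"] norm_D[OF f_D[OF assms]] by linarith
  then show "norm (\<psi> i x + a) \<le> (norm (x + a) + R) / (R + 1)"
    using R_pos unfolding Psi_trans by (simp add: divide_inverse mult.commute mult_left_mono)
next
  assume v: "v \<in> V"
  have "\<psi> i x + a - v = (x + a - v + (f i - R *\<^sub>R v)) /\<^sub>R (R + 1)"
  proof -
    have "v = ((R + 1) *\<^sub>R v) /\<^sub>R (R + 1)"
      using R_pos by simp
    then have "\<psi> i x + a - v = (x + a + f i) /\<^sub>R (R + 1) - ((R + 1) *\<^sub>R v) /\<^sub>R (R + 1)"
      unfolding Psi_trans by metis
    also have "\<dots> = (x + a - v + (f i - R *\<^sub>R v)) /\<^sub>R (R + 1)"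
      unfolding scaleR_diff_right[symmetric] by (simp add: algebra_simps)
    finally show ?thesis .
  qed
  moreover have "norm (x + a - v + (f i - R *\<^sub>R v)) \<le> norm (x + a - v) + \<tau> * R"
    using norm_triangle_ineq[of "x + a - v" "f i - R *\<^sub>R v"] dist_D[OF f_D[OF assms] v] by linarith
  ultimately show "norm (\<psi> i x + a - v) \<le> (norm (x + a - v) + \<tau> * R) / (R + 1)"
    using R_pos by (simp add: divide_inverse mult.commute mult_left_mono)
qed

lemma Psi_X: "i \<in> {1..N} \<Longrightarrow> \<psi> i ` X \<subseteq> X"
proof (intro subsetI)
  fix y assume i: "i \<in> {1..N}" and "y \<in> \<psi> i ` X"
  then obtain x where x: "x + a \<in> cell" "y = \<psi> i x"
    using mem_X by blast
  have "norm (y + a) \<le> 1"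
    using Psi_bounds(1)[OF i, of x] x R_pos
    by (smt (verit) cell_def divide_le_eq_1_pos mem_Collect_eq)
  moreover have "norm (y + a - v) \<le> \<tau>" if v: "v \<in> V" for v
  proof -
    have "norm (y + a - v) \<le> (\<tau> + \<tau> * R) / (R + 1)"
      using Psi_bounds(2)[OF i v, of x] x R_pos v
      by (intro order.trans[OF Psi_bounds(2)[OF i v, of x, folded x(2)]] divide_right_mono)
        (auto simp: cell_def)
    also have "\<dots> = \<tau>"
      using R_pos by (simp add: field_simps)
    finally show ?thesis .
  qed
  ultimately show "y \<in> X"
    unfolding mem_X by (simp add: cell_def)
qed

lemma fixed_points_trans: "fixed_points N (R + 1) trans \<subseteq> X"
proof
  fix x assume "x \<in> fixed_points N (R + 1) trans"
  then obtain i where i: "i \<in> {1..N}" "R *\<^sub>R (x + a) = f i"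
    by (auto simp: fixed_points_def Psi_fixed_iff)
  have "R * norm (x + a) = norm (f i)"
    using i(2) R_pos by (metis abs_of_pos norm_scaleR)
  then have "R * norm (x + a) \<le> R * 1"
    using norm_D[OF f_D[OF i(1)]] by simp
  then have "norm (x + a) \<le> 1"
    using R_pos mult_le_cancel_left_pos by blast
  moreover have "norm (x + a - v) \<le> \<tau>" if "v \<in> V" for v
  proof -
    have "R * norm (x + a - v) = norm (f i - R *\<^sub>R v)"
      using i(2) R_pos by (metis abs_of_pos norm_scaleR scaleR_diff_right)
    then have "R * norm (x + a - v) \<le> R * \<tau>"
      using dist_D[OF f_D[OF i(1)] that] by (simp add: mult.commute)
    then show ?thesis
      using R_pos mult_le_cancel_left_pos by blast
  qed
  ultimately show "x \<in> X"
    unfolding mem_X by (simp add: cell_def)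
qed

lemma compact_X: "compact X"
proof -
  have "cell = cball 0 1 \<inter> (\<Inter>v\<in>V. cball v \<tau>)"
    by (auto simp: cell_def dist_norm norm_minus_commute)
  moreover have "closed (\<Inter>v\<in>V. cball v \<tau>)"
    by (intro closed_INT) simp
  ultimately have "compact cell"
    by (simp add: compact_Int_closed)
  then show ?thesis
    using compact_translation_subtract by blast
qed

lemma corner_index:
  assumes "v \<in> V"
  obtains i where "i \<in> {1..N}" "f i = R *\<^sub>R v" "\<psi> i (v - a) = v - a"
proof -
  obtain i where "i \<in> {1..N}" "f i = R *\<^sub>R v"
    using f_surj[OF corner[OF assms]] by blast
  moreover from this have "\<psi> i (v - a) = v - a"
    unfolding Psi_fixed_iff by simp
  ultimately show thesis
    by (rule that)
qed

lemma N_pos: "N \<ge> 1"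
  using corner_index[OF a_V] by (metis atLeastAtMost_iff order.trans)

lemma V_fixed: "(\<lambda>v. v - a) ` V \<subseteq> fixed_points N (R + 1) trans"
proof
  fix x assume "x \<in> (\<lambda>v. v - a) ` V"
  then obtain v where v: "v \<in> V" "x = v - a"
    by blast
  obtain i where "i \<in> {1..N}" "\<psi> i x = x"
    using corner_index[OF v(1)] v(2) by metis
  then show "x \<in> fixed_points N (R + 1) trans"
    by (auto simp: fixed_points_def)
qed

lemma attractor_pattern:
  "\<K> \<subseteq> X" "(\<lambda>v. v - a) ` V \<subseteq> \<K>" "\<K> = (\<Union>i\<in>{1..N}. \<psi> i ` \<K>)"
proof -
  have L: "R + 1 > 1"
    using R_pos by simp
  have ne: "X \<noteq> {}"
    using V_subset_cell a_V by blast
  note * = attractor_within[OF L compact_X ne Psi_X N_pos fixed_points_trans]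
  show "\<K> \<subseteq> X" "(\<lambda>v. v - a) ` V \<subseteq> \<K>" "\<K> = (\<Union>i\<in>{1..N}. \<psi> i ` \<K>)"
    using *(2) *(3) V_fixed *(4) by blast+
qed

lemma meet_in_vertex:
  assumes "x \<in> X" "y \<in> X" "i \<in> {1..N}" "j \<in> {1..N}" "i \<noteq> j" "\<psi> i x = \<psi> j y"
  shows "x + a \<in> V" "y + a \<in> V" "x \<noteq> y"
proof -
  have "x + a + f i = y + a + f j"
    using assms(6) unfolding Psi_eq_iff by (simp add: algebra_simps)
  then have "x + a \<in> V \<and> y + a \<in> V \<and> norm (x + a - (y + a)) = \<tau>"
    using assms mem_X f_D f_eq_iff by (intro cells_meet_in_vertex) auto
  then show "x + a \<in> V" "y + a \<in> V" "x \<noteq> y"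
    using \<tau>_gt_1 by auto
qed

lemma mem_V_diff: "x \<in> (\<lambda>v. v - a) ` V \<longleftrightarrow> x + a \<in> V"
  by (metis (no_types, lifting) add_diff_cancel diff_add_cancel image_iff)

text \<open>All fixed points lie in \<open>X\<close>, so an essential one is a common point of two
  cells and hence a vertex. Conversely \<open>touching_at\<close> supplies a partner for every
  vertex, and the partner is a fixed point by \<open>V_fixed\<close>.\<close>

lemma essential: "V\<^sub>0 = (\<lambda>v. v - a) ` V"
proof (intro equalityI subsetI)
  fix x assume "x \<in> V\<^sub>0"
  then obtain y i j where xy: "x \<in> fixed_points N (R + 1) trans" "y \<in> fixed_points N (R + 1) trans"
    "i \<in> {1..N}" "j \<in> {1..N}" "\<psi> i \<noteq> \<psi> j" "\<psi> i x = \<psi> j y"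
    unfolding essential_fixed_points_def by blast
  then have "i \<noteq> j"
    by auto
  with xy show "x \<in> (\<lambda>v. v - a) ` V"
    unfolding mem_V_diff by (intro meet_in_vertex(1)[of x y i j] subsetD[OF fixed_points_trans])
next
  fix x assume x: "x \<in> (\<lambda>v. v - a) ` V"
  then have "x + a \<in> V"
    unfolding mem_V_diff .
  then obtain w d d' where w: "w \<in> V" "w \<noteq> x + a" "d \<in> D" "d' \<in> D" "d \<noteq> d'" "d + (x + a) = d' + w"
    by (rule touching_at)
  obtain i j where ij: "i \<in> {1..N}" "j \<in> {1..N}" "f i = d" "f j = d'"
    using f_surj w(3,4) by metis
  have "\<psi> i \<noteq> \<psi> j"
    using Psi_fun_eq_iff ij w(5) by auto
  moreover have "\<psi> i x = \<psi> j (w - a)"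
    using w(6) unfolding Psi_eq_iff ij by (simp add: algebra_simps)
  moreover have "w - a \<noteq> x"
    using w(2) by auto
  moreover have "w - a \<in> fixed_points N (R + 1) trans" "x \<in> fixed_points N (R + 1) trans"
    using V_fixed w(1) x by blast+
  ultimately show "x \<in> V\<^sub>0"
    unfolding essential_fixed_points_def using ij by blast
qed

lemma card_essential: "card V\<^sub>0 = card V"
  unfolding essential by (rule card_image) (simp add: inj_on_def)

lemma open_set_condition_pattern: "open_set_condition N (R + 1) trans"
  unfolding open_set_condition_def
\<comment> \<open>\<open>X\<close> with strict inequalities: two cells have at most vertices in
  common, and those have norm 1. The centre \<open>- a\<close> belongs to the set because
  \<open>\<tau> > 1\<close>.\<close>
proof (intro exI[of _ "{x. norm (x + a) < 1 \<and> (\<forall>v\<in>V. norm (x + a - v) < \<tau>)}"] conjI ballI impI)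
  let ?U = "{x. norm (x + a) < 1 \<and> (\<forall>v\<in>V. norm (x + a - v) < \<tau>)}"
  have U_X: "?U \<subseteq> X"
    by (intro subsetI, unfold mem_X) (auto simp: cell_def less_imp_le)
  have "?U = {x. norm (x + a) < 1} \<inter> (\<Inter>v\<in>V. {x. norm (x + a - v) < \<tau>})"
    by auto
  moreover have "open \<dots>"
    using finite_V by (intro open_Int open_INT ballI open_Collect_less continuous_intros) auto
  ultimately show "open ?U"
    by simp
  have "- a \<in> ?U"
    using norm_V \<tau>_gt_1 by simp
  then show "?U \<noteq> {}"
    by blast
  show "\<psi> i ` ?U \<inter> \<psi> j ` ?U = {}" if ij: "i \<in> {1..N}" "j \<in> {1..N}" "i \<noteq> j" for i j
  proof (rule ccontr)
    assume "\<psi> i ` ?U \<inter> \<psi> j ` ?U \<noteq> {}"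
    then obtain x y where xy: "x \<in> ?U" "y \<in> ?U" "\<psi> i x = \<psi> j y"
      by blast
    then have "x + a \<in> V"
      by (intro meet_in_vertex(1)[OF _ _ ij] subsetD[OF U_X])
    then show False
      using norm_V xy(1) by force
  qed
  show "(\<Union>i\<in>{1..N}. \<psi> i ` ?U) \<subseteq> ?U"
  proof (intro UN_least subsetI)
    fix i y assume i: "i \<in> {1..N}" and "y \<in> \<psi> i ` ?U"
    then obtain x where x: "x \<in> ?U" "y = \<psi> i x"
      by blast
    have "norm (y + a) < 1"
      using order.strict_trans1[OF Psi_bounds(1)[OF i, of x], of 1] x R_pos by simp
    moreover have "norm (y + a - v) < \<tau>" if "v \<in> V" for v
    proof -
      have "norm (x + a - v) + \<tau> * R < \<tau> * (R + 1)"
        using x(1) that by (simp add: algebra_simps)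
      then have "(norm (x + a - v) + \<tau> * R) / (R + 1) < \<tau>"
        using R_pos by (simp add: divide_less_eq)
      then show ?thesis
        using Psi_bounds(2)[OF i that, of x] x(2) by simp
    qed
    ultimately show "y \<in> ?U"
      by simp
  qed
qed

lemma nesting_pattern: "nesting N (R + 1) trans"
  unfolding nesting_def Let_def essential
proof (intro ballI impI equalityI subsetI)
  fix i j z assume ij: "i \<in> {1..N}" "j \<in> {1..N}" "i \<noteq> j"
  show "z \<in> \<psi> i ` (\<lambda>v. v - a) ` V \<inter> \<psi> j ` (\<lambda>v. v - a) ` V" if z: "z \<in> \<psi> i ` \<K> \<inter> \<psi> j ` \<K>"
  proof -
    obtain x y where xy: "x \<in> \<K>" "y \<in> \<K>" "z = \<psi> i x" "z = \<psi> j y"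
      using z by blast
    then have "x \<in> (\<lambda>v. v - a) ` V" "y \<in> (\<lambda>v. v - a) ` V"
      unfolding mem_V_diff using meet_in_vertex[of x y i j] ij attractor_pattern(1) by auto
    then show ?thesis
      using xy(3,4) by blast
  qed
  show "z \<in> \<psi> i ` \<K> \<inter> \<psi> j ` \<K>"
    if "z \<in> \<psi> i ` (\<lambda>v. v - a) ` V \<inter> \<psi> j ` (\<lambda>v. v - a) ` V"
    using that attractor_pattern(2) by blast
qed

lemma bisector_reflection_translate:
  "bisector_reflection (x - a) (y - a) (z - a) = bisector_reflection x y z - a"
proof -
  have "midpoint (x - a) (y - a) = midpoint x y - a"
    by (simp add: midpoint_def scaleR_diff_right scaleR_add_right algebra_simps)
      (simp flip: scaleR_add_left)
  then show ?thesis
    by (simp add: bisector_reflection_def)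
qed

lemma symmetry_pattern: "symmetry N (R + 1) trans"
  unfolding symmetry_def Let_def essential
proof (intro ballI impI)
  fix i x y assume i: "i \<in> {1..N}" and "x \<in> (\<lambda>v. v - a) ` V" "y \<in> (\<lambda>v. v - a) ` V" and "x \<noteq> y"
  then obtain v w where vw: "v \<in> V" "w \<in> V" "x = v - a" "y = w - a" "v \<noteq> w"
    by blast
  let ?S = "bisector_reflection v w"
  obtain j where j: "j \<in> {1..N}" "f j = ?S (f i)"
    using f_surj reflect_D[OF vw(1,2,5) f_D[OF i]] by blast
  have "bisector_reflection x y (\<psi> i (u - a)) = \<psi> j (?S u - a)" for u
  proof -
    have "bisector_reflection x y (\<psi> i (u - a)) = ?S (\<psi> i (u - a) + a) - a"
      using bisector_reflection_translate[of v w "\<psi> i (u - a) + a"] vw by simp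
    also have "\<dots> = (?S u + f j) /\<^sub>R (R + 1) - a"
      unfolding Psi_trans bisector_reflection_add(2)[OF vw(1,2)]
      by (simp add: bisector_reflection_add(1)[OF vw(1,2)] j(2))
    also have "\<dots> = \<psi> j (?S u - a)"
      using Psi_trans[of j "?S u - a"] by (simp add: algebra_simps)
    finally show ?thesis .
  qed
  then have "bisector_reflection x y ` \<psi> i ` (\<lambda>v. v - a) ` V = \<psi> j ` (\<lambda>v. v - a) ` ?S ` V"
    by (simp add: image_image)
  then show "\<exists>j\<in>{1..N}. bisector_reflection x y ` \<psi> i ` (\<lambda>v. v - a) ` V = \<psi> j ` (\<lambda>v. v - a) ` V"
    unfolding reflect_V[OF vw(1,2,5)] using j(1) by blast
qed

lemma connectivity_pattern: "connectivity N (R + 1) trans"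
  unfolding connectivity_def Let_def essential
proof (intro ballI)
  let ?V = "\<Union>i\<in>{1..N}. \<psi> i ` (\<lambda>v. v - a) ` V"
  let ?E = "{(x, y) \<in> ?V \<times> ?V. \<exists>i\<in>{1..N}. x \<in> \<psi> i ` \<K> \<and> y \<in> \<psi> i ` \<K>}"
  have same: "(\<psi> i (v - a), \<psi> i (w - a)) \<in> ?E" if "i \<in> {1..N}" "v \<in> V" "w \<in> V" for i v w
    using that attractor_pattern(2) by blast
  \<comment> \<open>A path of touching cells becomes a path of vertices: inside a cell any two
    vertices are joined, and the vertex shared by consecutive cells is counted in both. The end
    \<open>d\<close> is a variable tied to \<open>f j\<close> by a premise, so that the induction
    runs over cells and not over indices.\<close>
  have step: "(\<psi> i (v - a), \<psi> j (w - a)) \<in> ?E\<^sup>*"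
    if "(f i, d) \<in> {(d, d') \<in> D \<times> D. touching \<tau> V d d'}\<^sup>*" "d = f j" "i \<in> {1..N}" "j \<in> {1..N}"
      "v \<in> V" "w \<in> V" for i j d v w
    using that
  proof (induction arbitrary: j w rule: rtrancl_induct)
    case base
    then have "i = j"
      using f_eq_iff by blast
    then show ?case
      using same[OF base(2,4,5)] by (simp only: r_into_rtrancl)
  next
    case (step c d)
    then obtain m where m: "m \<in> {1..N}" "c = f m"
      using f_surj by blast
    obtain v' w' where vw: "v' \<in> V" "w' \<in> V" "c - d = v' - w'"
      using step.hyps(2) by (auto simp: touching_def)
    have "(\<psi> i (v - a), \<psi> m (w' - a)) \<in> ?E\<^sup>*"
      by (rule step.IH[OF m(2) step.prems(2) m(1) step.prems(4) vw(2)])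
    moreover have "\<psi> m (w' - a) = \<psi> j (v' - a)"
      unfolding Psi_eq_iff using vw(3) m(2) step.prems(1) by (simp add: algebra_simps)
    moreover have "(\<psi> j (v' - a), \<psi> j (w - a)) \<in> ?E"
      by (rule same[OF step.prems(3) vw(1) step.prems(5)])
    ultimately show ?case
      by (simp only: rtrancl.rtrancl_into_rtrancl)
  qed
  fix x y assume "x \<in> ?V" "y \<in> ?V"
  then obtain i j v w where "i \<in> {1..N}" "j \<in> {1..N}" "v \<in> V" "w \<in> V"
    "x = \<psi> i (v - a)" "y = \<psi> j (w - a)"
    by blast
  then show "(x, y) \<in> ?E\<^sup>*"
    using step[OF linked[OF f_D f_D] refl, of i j v w] by simp
qed

lemma trans_zero: "\<exists>i\<in>{1..N}. trans i = 0"
proof -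
  obtain i where "i \<in> {1..N}" "f i = R *\<^sub>R a"
    using corner_index[OF a_V] by blast
  then show ?thesis
    by (auto simp: trans_def)
qed

text \<open>The \<open>0\<close>-complexes with \<open>J = 1\<close> suffice; the conjugation moves the cell at \<open>d\<close> to
  \<open>d - R a\<close>.\<close>

lemma zero_complex:
  assumes "d \<in> D"
  shows "d - R *\<^sub>R a \<in> zero_complexes N (R + 1) trans"
proof -
  obtain i where i: "i \<in> {1..N}" "f i = d"
    using f_surj[OF assms] by blast
  have d: "d - R *\<^sub>R a = (R + 1) *\<^sub>R trans i"
    using R_pos by (simp add: trans_def i(2))
  \<comment> \<open>The translate of \<open>\<K>\<close> is the cell of the map \<open>i\<close>
    enlarged by \<open>R + 1\<close>, so it lies in the first enlargement of
    \<open>\<K>\<close>.\<close>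
  have "x + (d - R *\<^sub>R a) = (R + 1) *\<^sub>R \<psi> i x" for x
    using R_pos unfolding d by (simp add: Psi_def scaleR_add_right)
  then have "(\<lambda>x. x + (d - R *\<^sub>R a)) ` \<K> = (\<lambda>x. (R + 1) ^ 1 *\<^sub>R x) ` \<psi> i ` \<K>"
    by (simp add: image_image)
  also have "\<dots> \<subseteq> (\<lambda>x. (R + 1) ^ 1 *\<^sub>R x) ` \<K>"
    using attractor_pattern(3) i(1) by blast
  also have "\<dots> \<subseteq> unbounded_fractal N (R + 1) trans"
    unfolding unbounded_fractal_def by blast
  finally show ?thesis
    unfolding zero_complexes_def using i(1) d by (auto intro!: exI[of _ 1] exI[of _ "\<lambda>_. i"])
qed

end

lemma simple_nested_pattern:
  fixes V D :: "(real ^ 2) set"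
  assumes "numbered_pattern V D \<tau> R a f N"
  shows "simple_nested_fractal N (R + 1) (numbered_pattern.trans R a f)"
proof -
  interpret numbered_pattern V D \<tau> R a f N
    by fact
  show ?thesis
    unfolding simple_nested_fractal_def card_essential
    using R_pos trans_zero card_V open_set_condition_pattern nesting_pattern symmetry_pattern
      connectivity_pattern by simp
qed

text \<open>This removes the labels: they are injective on \<open>V\<^sub>0\<close>, so a vertex
  shared by two cells must have the same image in \<open>V\<^sub>0\<close> from both. As
  \<open>V\<close> sums to 0, the barycenter is \<open>- a\<close>, and the rotations become linear
  after the translation by \<open>a\<close>.\<close>

lemma GLP_pattern:
  fixes V D :: "(real ^ 2) set"
  assumes "numbered_pattern V D \<tau> R a f N" and sum0: "\<Sum>V = 0"
    and "GLP N (R + 1) (numbered_pattern.trans R a f)"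
  obtains A :: "real ^ 2 \<Rightarrow> real ^ 2 ^ 2" where "\<And>d. d \<in> D \<Longrightarrow> rotation_matrix (A d)"
    "\<And>d d' x y. \<lbrakk>d \<in> D; d' \<in> D; x \<in> V; y \<in> V; d + x = d' + y\<rbrakk> \<Longrightarrow> A d *v x = A d' *v y"
proof -
  interpret numbered_pattern V D \<tau> R a f N
    by fact
  have V0: "V\<^sub>0 = (\<lambda>v. v - a) ` V"
    by (rule essential)
  have "(\<Sum>v\<in>V\<^sub>0. v) = (\<Sum>v\<in>V. v - a)"
    unfolding V0 by (simp add: sum.reindex inj_on_def)
  also have "\<dots> = - real (card V) *\<^sub>R a"
    using sum0 by (simp add: sum_subtractf sum_constant_scaleR del: sum_constant)
  finally have bary: "barycenter N (R + 1) trans = - a"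
    using card_V by (simp add: barycenter_def card_essential)
  obtain l :: "real ^ 2 \<Rightarrow> nat" where l: "inj_on l V\<^sub>0"
    "\<And>d. d \<in> zero_complexes N (R + 1) trans \<Longrightarrow> \<exists>\<rho>\<in>vertex_rotations N (R + 1) trans.
       \<forall>v\<in>complex_vertices N (R + 1) trans d. l v = l (\<rho> (v - d))"
    using assms(3) unfolding GLP_def Let_def by (auto dest: bij_betw_imp_inj_on)
  \<comment> \<open>\<open>d + x - (R + 1) a\<close> is the vertex \<open>x - a\<close> shifted by
    \<open>d - R a\<close>. It depends on \<open>d + x\<close> alone, so all cells that contain this
    point refer to the same label.\<close>
  have "\<exists>A :: real ^ 2 ^ 2. rotation_matrix A \<and> (\<forall>x\<in>V. A *v x \<in> V \<and> l (d + x - (R + 1) *\<^sub>R a) = l (A *v x - a))"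
    if d: "d \<in> D" for d
  proof -
    obtain \<rho> where \<rho>: "\<rho> \<in> vertex_rotations N (R + 1) trans"
      "\<And>v. v \<in> complex_vertices N (R + 1) trans (d - R *\<^sub>R a) \<Longrightarrow> l v = l (\<rho> (v - (d - R *\<^sub>R a)))"
      using l(2)[OF zero_complex[OF d]] by blast
    obtain A :: "real ^ 2 ^ 2" where A: "rotation_matrix A" "\<And>x. \<rho> x = A *v (x + a) - a"
      using \<rho>(1) by (auto simp: vertex_rotations_def rotation_about_def bary)
    have \<rho>V: "\<rho> ` (\<lambda>v. v - a) ` V = (\<lambda>v. v - a) ` V"
      using \<rho>(1) by (simp add: vertex_rotations_def V0)
    have "A *v x \<in> V \<and> l (d + x - (R + 1) *\<^sub>R a) = l (A *v x - a)" if x: "x \<in> V" for x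
    proof
      have "\<rho> (x - a) \<in> (\<lambda>v. v - a) ` V"
        using \<rho>V x by blast
      then show "A *v x \<in> V"
        by (auto simp: A(2))
      have "x - a + (d - R *\<^sub>R a) \<in> complex_vertices N (R + 1) trans (d - R *\<^sub>R a)"
        using x unfolding complex_vertices_def V0 by blast
      from \<rho>(2)[OF this] show "l (d + x - (R + 1) *\<^sub>R a) = l (A *v x - a)"
        by (simp add: A(2) algebra_simps)
    qed
    then show ?thesis
      using A(1) by blast
  qed
  then obtain A :: "real ^ 2 \<Rightarrow> real ^ 2 ^ 2" where A: "\<And>d. d \<in> D \<Longrightarrow> rotation_matrix (A d)"
    "\<And>d x. d \<in> D \<Longrightarrow> x \<in> V \<Longrightarrow> A d *v x \<in> V"
    "\<And>d x. d \<in> D \<Longrightarrow> x \<in> V \<Longrightarrow> l (d + x - (R + 1) *\<^sub>R a) = l (A d *v x - a)"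
    by metis
  have "A d *v x = A d' *v y" if "d \<in> D" "d' \<in> D" "x \<in> V" "y \<in> V" "d + x = d' + y" for d d' x y
  proof -
    have "l (A d *v x - a) = l (A d' *v y - a)"
      using A(3)[of d x] A(3)[of d' y] that by simp
    moreover have "A d *v x - a \<in> V\<^sub>0" "A d' *v y - a \<in> V\<^sub>0"
      unfolding V0 using A(2) that by blast+
    ultimately show ?thesis
      using inj_onD[OF l(1)] by fastforce
  qed
  then show thesis
    using that[of A] A(1) by blast
qed

section \<open>Transport from the complex plane to \<open>real ^ 2\<close>\<close>

lemma rtrancl_image:
  assumes "(x, y) \<in> r\<^sup>*" "\<And>x y. (x, y) \<in> r \<Longrightarrow> (h x, h y) \<in> s"
  shows "(h x, h y) \<in> s\<^sup>*"
  using assms(1) by induction (auto intro: assms(2) rtrancl_into_rtrancl)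

text \<open>Patterns are built in the complex plane, where rotations are products, but the fractal
  has to live in \<open>real ^ 2\<close>. Bisector reflections are defined by inner products and
  therefore commute with \<open>g\<close>.\<close>

lemma cell_pattern_isometry:
  fixes g :: "'a::euclidean_space \<Rightarrow> 'b::euclidean_space"
  assumes "cell_pattern V D \<tau> R" and g: "linear g" and norm_g: "\<And>x. norm (g x) = norm x"
  shows "cell_pattern (g ` V) (g ` D) \<tau> R"
proof -
  interpret cell_pattern V D \<tau> R
    by fact
  note lin = linear_diff[OF g] linear_add[OF g] linear_scale[OF g]
  have norm_diff: "norm (g x - g y) = norm (x - y)" for x y
    using norm_g[of "x - y"] by (simp add: lin)
  have inj: "inj_on g A" for A
    using norm_diff by (metis inj_onI norm_eq_zero right_minus_eq)
  have inner: "g x \<bullet> g y = x \<bullet> y" for x y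
    unfolding dot_norm by (metis lin(2) norm_g)
  have refl: "bisector_reflection (g x) (g y) (g z) = g (bisector_reflection x y z)" for x y z
    by (simp add: bisector_reflection_def midpoint_def inner lin flip: lin)
  have touch: "touching \<tau> (g ` V) (g d) (g d')" if "touching \<tau> V d d'" for d d'
    using that unfolding touching_def by (metis imageI lin(1) norm_diff)
  show ?thesis
  proof
    show "finite (g ` V)" "finite (g ` D)" "0 < R" "1 < \<tau>"
      using finite_V finite_D R_pos \<tau>_gt_1 by auto
    show "2 \<le> card (g ` V)"
      using card_V by (simp add: card_image[OF inj])
    show "norm v = 1" if "v \<in> g ` V" for v
      using that norm_V by (auto simp: norm_g)
    show "norm (v - w) \<le> \<tau>" if "v \<in> g ` V" "w \<in> g ` V" for v w
      using that dist_V by (auto simp: norm_diff)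
    show "norm d \<le> R" if "d \<in> g ` D" for d
      using that norm_D by (auto simp: norm_g)
    show "norm (d - R *\<^sub>R v) \<le> \<tau> * R" if "d \<in> g ` D" "v \<in> g ` V" for d v
      using that dist_D by (auto simp: norm_diff simp flip: lin(3))
    show "R *\<^sub>R v \<in> g ` D" if "v \<in> g ` V" for v
      using that corner by (auto simp flip: lin(3))
    show "touching \<tau> (g ` V) d d' \<or> 2 < norm (d - d')"
      if "d \<in> g ` D" "d' \<in> g ` D" "d \<noteq> d'" for d d'
      using that separated touch by (auto simp: norm_diff) blast
    show "bisector_reflection x y ` g ` V = g ` V" if xy: "x \<in> g ` V" "y \<in> g ` V" "x \<noteq> y" for x y
    proof -
      obtain v w where "v \<in> V" "w \<in> V" "x = g v" "y = g w" "v \<noteq> w"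
        using xy by blast
      then have "bisector_reflection x y ` g ` V = g ` bisector_reflection v w ` V"
        by (simp add: image_image refl)
      then show ?thesis
        using reflect_V \<open>v \<in> V\<close> \<open>w \<in> V\<close> \<open>v \<noteq> w\<close> by simp
    qed
    show "bisector_reflection x y d \<in> g ` D"
      if "x \<in> g ` V" "y \<in> g ` V" "x \<noteq> y" "d \<in> g ` D" for x y d
      using that reflect_D by (auto simp: refl intro!: imageI reflect_D)
    have "(g d, g d') \<in> {(d, d') \<in> g ` D \<times> g ` D. touching \<tau> (g ` V) d d'}\<^sup>*"
      if "(d, d') \<in> {(d, d') \<in> D \<times> D. touching \<tau> V d d'}\<^sup>*" for d d'
      by (rule rtrancl_image[OF that]) (use touch in blast)
    then show "(d, d') \<in> {(d, d') \<in> g ` D \<times> g ` D. touching \<tau> (g ` V) d d'}\<^sup>*"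
      if "d \<in> g ` D" "d' \<in> g ` D" for d d'
      using that linked by blast
  qed
qed

definition vec_of_complex :: "complex \<Rightarrow> real ^ 2" where
  "vec_of_complex z = vector [Re z, Im z]"

lemma vec_of_complex_nth [simp]: "vec_of_complex z $ 1 = Re z" "vec_of_complex z $ 2 = Im z"
  by (simp_all add: vec_of_complex_def)

lemma linear_vec_of_complex: "linear vec_of_complex"
  by (rule linearI) (simp_all add: vec_eq_iff forall_2)

lemma norm_vec_of_complex: "norm (vec_of_complex z) = norm z"
  by (simp add: norm_vec_def L2_set_def sum_2 cmod_def)

lemma vec_of_complex_eq_iff: "vec_of_complex z = vec_of_complex w \<longleftrightarrow> z = w"
  by (auto simp: vec_eq_iff forall_2 complex_eq_iff)

text \<open>Orthogonality and determinant 1 leave the matrices of multiplication by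
  \<open>a + b i\<close>. That \<open>\<zeta>\<close> is nonzero is recorded for the cancellation
  that ends the ring argument.\<close>

lemma rotation_matrix_complex:
  fixes A :: "real ^ 2 ^ 2"
  assumes "rotation_matrix A"
  obtains \<zeta> where "\<zeta> \<noteq> 0" "\<And>z. A *v vec_of_complex z = vec_of_complex (\<zeta> * z)"
proof -
  have orth: "transpose A ** A = mat 1" and det: "A$1$1 * A$2$2 - A$1$2 * A$2$1 = 1"
    using assms by (auto simp: rotation_matrix_def orthogonal_matrix_def det_2)
  have *: "(transpose A ** A) $ i $ j = A$1$i * A$1$j + A$2$i * A$2$j" for i j
    by (simp add: matrix_matrix_mult_def transpose_def sum_2)
  have 1: "A$1$1 * A$1$1 + A$2$1 * A$2$1 = 1" and 2: "A$1$1 * A$1$2 + A$2$1 * A$2$2 = 0"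
    using *[of 1 1] *[of 1 2] by (simp_all add: orth mat_def)
  have 3: "A$2$2 = A$1$1" and 4: "A$1$2 = - A$2$1"
    using 1 2 det by algebra+
  show thesis
  proof (rule that[of "Complex (A$1$1) (A$2$1)"])
    show "Complex (A$1$1) (A$2$1) \<noteq> 0"
      using 1 by (auto simp: complex_eq_iff)
    show "A *v vec_of_complex z = vec_of_complex (Complex (A$1$1) (A$2$1) * z)" for z
      by (simp add: vec_eq_iff forall_2 matrix_vector_mult_def sum_2 3 4)
  qed
qed

text \<open>The interface to the rest of the proof: from here on there are just positions in the
  complex plane and nonzero numbers \<open>\<zeta> d\<close> that have to agree at shared
  vertices.\<close>

lemma snf_without_GLP:
  fixes V D :: "complex set"
  assumes pattern: "cell_pattern V D \<tau> R" and sum0: "\<Sum>V = 0"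
    and no_labels: "\<And>\<zeta> :: complex \<Rightarrow> complex. (\<And>d. d \<in> D \<Longrightarrow> \<zeta> d \<noteq> 0) \<Longrightarrow>
      (\<And>d d' x y. \<lbrakk>d \<in> D; d' \<in> D; x \<in> V; y \<in> V; d + x = d' + y\<rbrakk> \<Longrightarrow> \<zeta> d * x = \<zeta> d' * y) \<Longrightarrow> False"
  shows "\<exists>N L \<nu>. simple_nested_fractal N L \<nu> \<and> card (essential_fixed_points N L \<nu>) = card V \<and> \<not> GLP N L \<nu>"
proof -
  let ?g = vec_of_complex
  interpret cell_pattern "?g ` V" "?g ` D" \<tau> R
    using cell_pattern_isometry[OF pattern linear_vec_of_complex norm_vec_of_complex] .
  obtain a where a: "a \<in> ?g ` V"
    using card_V by (metis all_not_in_conv card.empty not_numeral_le_zero)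
  obtain f where f: "bij_betw f {1..card (?g ` D)} (?g ` D)"
    using ex_bij_betw_nat_finite_1[OF finite_D] by blast
  have np: "numbered_pattern (?g ` V) (?g ` D) \<tau> R a f (card (?g ` D))"
    by unfold_locales (use a f in auto)
  then interpret numbered_pattern "?g ` V" "?g ` D" \<tau> R a f "card (?g ` D)" .
  have inj: "inj_on ?g B" for B
    by (simp add: inj_on_def vec_of_complex_eq_iff)
  have card: "card (essential_fixed_points (card (?g ` D)) (R + 1) trans) = card V"
    unfolding card_essential by (rule card_image[OF inj])
  have "\<not> GLP (card (?g ` D)) (R + 1) trans"
  proof
    assume glp: "GLP (card (?g ` D)) (R + 1) trans"
    have "\<Sum>(?g ` V) = ?g (\<Sum>V)"
      by (simp add: sum.reindex[OF inj] linear_sum[OF linear_vec_of_complex])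
    then have "\<Sum>(?g ` V) = 0"
      using sum0 linear_0[OF linear_vec_of_complex] by simp
    then obtain A :: "real ^ 2 \<Rightarrow> real ^ 2 ^ 2" where A: "\<And>d. d \<in> ?g ` D \<Longrightarrow> rotation_matrix (A d)"
      "\<And>d d' x y. \<lbrakk>d \<in> ?g ` D; d' \<in> ?g ` D; x \<in> ?g ` V; y \<in> ?g ` V; d + x = d' + y\<rbrakk>
        \<Longrightarrow> A d *v x = A d' *v y"
      using GLP_pattern[OF np _ glp] by blast
    have "\<exists>\<zeta>. \<zeta> \<noteq> 0 \<and> (\<forall>z. A (?g d) *v ?g z = ?g (\<zeta> * z))" if "d \<in> D" for d
      using rotation_matrix_complex[OF A(1)[of "?g d"]] that by blast
    then obtain \<zeta> where \<zeta>: "\<And>d. d \<in> D \<Longrightarrow> \<zeta> d \<noteq> 0"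
      "\<And>d z. d \<in> D \<Longrightarrow> A (?g d) *v ?g z = ?g (\<zeta> d * z)"
      by metis
    show False
    proof (rule no_labels[OF \<zeta>(1)])
      fix d d' x y assume *: "d \<in> D" "d' \<in> D" "x \<in> V" "y \<in> V" "d + x = d' + y"
      then have "?g d + ?g x = ?g d' + ?g y"
        by (metis linear_add linear_vec_of_complex)
      then have "A (?g d) *v ?g x = A (?g d') *v ?g y"
        using A(2) * by blast
      then show "\<zeta> d * x = \<zeta> d' * y"
        using * by (simp add: \<zeta>(2) vec_of_complex_eq_iff)
    qed
  qed
  then show ?thesis
    using simple_nested_pattern[OF np] card by blast
qed

section \<open>Patterns with the symmetries of a regular polygon\<close>

text \<open>The bisector passes through 0, so the reflection has the form
  \<open>z \<mapsto> u * cnj z\<close>, and \<open>u = x * y\<close> is the choice that takes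
  \<open>x\<close> to \<open>y\<close>. Invariance of a set thus reduces to closure under
  \<open>cnj\<close> and under multiplication by vertices.\<close>

lemma bisector_reflection_complex:
  assumes "norm x = 1" "norm y = 1" "x \<noteq> y"
  shows "bisector_reflection x y z = x * y * cnj z"
proof -
  have nz: "x \<noteq> 0" "y \<noteq> 0" "y - x \<noteq> 0"
    using assms by auto
  have inv: "cnj x = 1 / x" "cnj y = 1 / y"
    using assms nz by (simp_all add: divide_conv_cnj)
  have "midpoint x y \<bullet> (y - x) = (norm y^2 - norm x^2) / 2"
    by (simp add: midpoint_def inner_simps power2_norm_eq_inner inner_commute)
  then have mid: "(z - midpoint x y) \<bullet> (y - x) = z \<bullet> (y - x)"
    using assms by (simp add: inner_diff_left)
  have zi: "complex_of_real (2 * (z \<bullet> (y - x))) = z * cnj (y - x) + cnj z * (y - x)"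
    by (simp add: complex_eq_iff inner_complex_def algebra_simps)
  have yi: "complex_of_real ((y - x) \<bullet> (y - x)) = (y - x) * cnj (y - x)"
    by (simp add: complex_eq_iff inner_complex_def algebra_simps)
  have "bisector_reflection x y z
      = z - (z * cnj (y - x) + cnj z * (y - x)) / ((y - x) * cnj (y - x)) * (y - x)"
    unfolding bisector_reflection_def mid scaleR_conv_of_real of_real_divide zi yi ..
  also have "\<dots> = - (cnj z * (y - x) / cnj (y - x))"
  proof -
    have "p - (p * c + q * w) / (w * c) * w = - (q * w / c)" if "w \<noteq> 0" "c \<noteq> 0" for p q w c :: complex
      using that by (simp add: field_simps)
    then show ?thesis
      using nz(3) complex_cnj_zero_iff by blast
  qed
  also have "cnj (y - x) = - ((y - x) / (x * y))"
    using nz by (simp add: inv field_simps)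
  also have "- (cnj z * (y - x) / - ((y - x) / (x * y))) = x * y * cnj z"
    using nz by (simp add: field_simps)
  finally show ?thesis .
qed

lemma norm_diff_cis: "norm (cis a - cis b) = 2 * \<bar>sin ((a - b) / 2)\<bar>"
proof (rule power2_eq_imp_eq)
  have "(norm (cis a - cis b))\<^sup>2 = (cos a - cos b)\<^sup>2 + (sin a - sin b)\<^sup>2"
    by (simp add: cmod_power2)
  also have "\<dots> = 2 - 2 * cos (a - b)"
    using sin_cos_squared_add[of a] sin_cos_squared_add[of b]
    unfolding cos_diff by (simp only: power2_diff) algebra
  also have "cos (a - b) = 1 - 2 * (sin ((a - b) / 2))\<^sup>2"
    using cos_double_sin[of "(a - b) / 2"] by (simp only: mult_2 field_sum_of_halves)
  finally show "(norm (cis a - cis b))\<^sup>2 = (2 * \<bar>sin ((a - b) / 2)\<bar>)\<^sup>2"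
    by (simp add: power_mult_distrib)
qed auto

lemma cos_le_cos_of_between:
  assumes "0 \<le> \<delta>" "\<delta> \<le> \<theta>" "\<theta> \<le> 2 * pi - \<delta>"
  shows "cos \<theta> \<le> cos \<delta>"
proof (cases "\<theta> \<le> pi")
  case False
  have "cos \<theta> = cos (2 * pi - \<theta>)"
    by (simp add: cos_diff)
  also have "\<dots> \<le> cos \<delta>"
    using False assms by (intro cos_monotone_0_pi_le) auto
  finally show ?thesis .
qed (use assms in \<open>auto intro: cos_monotone_0_pi_le\<close>)

text \<open>The law of cosines with the square completed in \<open>s\<close>:
  \<open>r * sin \<delta>\<close> is the distance of the first point from a line at angle
  \<open>\<delta>\<close>.\<close>

lemma norm_diff_ge_sin:
  assumes "0 \<le> r" "0 \<le> s" "0 \<le> \<delta>" "\<delta> \<le> pi" "cos (\<alpha> - \<beta>) \<le> cos \<delta>"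
  shows "norm (rcis r \<alpha> - rcis s \<beta>) \<ge> r * sin \<delta>"
proof (rule power2_le_imp_le)
  have "(norm (rcis r \<alpha> - rcis s \<beta>))\<^sup>2
      = (r * cos \<alpha> - s * cos \<beta>)\<^sup>2 + (r * sin \<alpha> - s * sin \<beta>)\<^sup>2"
    by (simp add: cmod_power2)
  also have "\<dots> = r\<^sup>2 * ((sin \<alpha>)\<^sup>2 + (cos \<alpha>)\<^sup>2) + s\<^sup>2 * ((sin \<beta>)\<^sup>2 + (cos \<beta>)\<^sup>2) - 2 * (r * s) * cos (\<alpha> - \<beta>)"
    unfolding cos_diff by algebra
  also have "\<dots> = r\<^sup>2 + s\<^sup>2 - 2 * (r * s) * cos (\<alpha> - \<beta>)"
    by simp
  also have "\<dots> \<ge> r\<^sup>2 + s\<^sup>2 - 2 * (r * s) * cos \<delta>"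
    using assms by (simp add: mult_left_mono)
  also have "r\<^sup>2 + s\<^sup>2 - 2 * (r * s) * cos \<delta> = (s - r * cos \<delta>)\<^sup>2 + r\<^sup>2 * (1 - (cos \<delta>)\<^sup>2)"
    by algebra
  also have "\<dots> = (s - r * cos \<delta>)\<^sup>2 + (r * sin \<delta>)\<^sup>2"
    by (simp add: power_mult_distrib flip: sin_squared_eq)
  finally show "(r * sin \<delta>)\<^sup>2 \<le> (norm (rcis r \<alpha> - rcis s \<beta>))\<^sup>2"
    using zero_le_power2[of "s - r * cos \<delta>"] by linarith
qed auto

section \<open>Geometry of the regular \<open>k\<close>-gon\<close>

locale regular_polygon =
  fixes k :: nat
  assumes k_ge_3: "k \<ge> 3"
begin

definition V :: "complex set" where
  "V = {z. z ^ k = 1}"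

text \<open>The diameter of \<open>V\<close>: the chord between vertices \<open>k div 2\<close>
  places apart.\<close>

definition \<tau> :: real where
  "\<tau> = 2 * sin (pi * real (k div 2) / real k)"

abbreviation \<epsilon> :: complex where
  "\<epsilon> \<equiv> cis (pi / real k)"

abbreviation vertex :: "nat \<Rightarrow> complex" where
  "vertex n \<equiv> cis (2 * pi * real n / real k)"

lemma V_eq: "V = vertex ` {..<k}"
  using Complex.bij_betw_roots_unity[of k] k_ge_3 unfolding V_def bij_betw_def by simp

lemma vertex_V: "vertex n \<in> V"
proof -
  have "real k * (2 * pi * real n / real k) = 2 * pi * real n"
    using k_ge_3 by simp
  then have "vertex n ^ k = cis (2 * pi * real n)"
    by (simp only: Complex.DeMoivre)
  then show ?thesis
    by (simp add: V_def cis_multiple_2pi)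
qed

lemma V_norm: "v \<in> V \<Longrightarrow> norm v = 1"
  by (auto simp: V_eq)

lemma V_cnj_mult: "v \<in> V \<Longrightarrow> v * cnj v = 1" "v \<in> V \<Longrightarrow> cnj v * v = 1"
  using V_norm by (simp_all add: complex_norm_square[symmetric] mult.commute)

lemma V_closed: "1 \<in> V" "v \<in> V \<Longrightarrow> w \<in> V \<Longrightarrow> v * w \<in> V" "v \<in> V \<Longrightarrow> cnj v \<in> V"
  by (auto simp: V_def power_mult_distrib simp flip: complex_cnj_power)

lemma card_V_eq: "card V = k"
  unfolding V_def by (rule card_roots_unity_eq) (use k_ge_3 in simp)

lemma finite_roots: "finite V"
  using card_V_eq k_ge_3 card.infinite by fastforce

lemma sum_V: "\<Sum>V = 0"
  unfolding V_def by (rule sum_roots_unity) (use k_ge_3 in simp)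

text \<open>Chords over \<open>n\<close> and over \<open>k - n\<close> places are equally long, and
  up to \<open>k div 2\<close> places the sine increases.\<close>

lemma dist_one_root_le:
  assumes "v \<in> V"
  shows "norm (1 - v) \<le> \<tau>"
proof -
  obtain n where n: "n < k" "v = vertex n"
    using assms V_eq by auto
  have pos: "real k > 0"
    using k_ge_3 by simp
  have le: "sin (pi * real m / real k) \<le> sin (pi * real (k div 2) / real k)" if "m \<le> k div 2" for m
  proof (rule sin_monotone_2pi_le)
    have "real (k div 2) \<le> real k / 2"
      by linarith
    then show "pi * real (k div 2) / real k \<le> pi / 2"
      using pos by (simp add: field_simps)
    have "0 \<le> pi * real m / real k"
      by simp
    then show "- (pi / 2) \<le> pi * real m / real k"
      using pi_gt_zero by linarith
    show "pi * real m / real k \<le> pi * real (k div 2) / real k"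
      using that pos by (intro divide_right_mono mult_left_mono) auto
  qed
  have "norm (1 - v) = norm (cis 0 - cis (2 * pi * real n / real k))"
    by (simp add: n(2))
  also have "\<dots> = 2 * \<bar>sin (- (pi * real n / real k))\<bar>"
    unfolding norm_diff_cis by simp
  also have "\<dots> = 2 * sin (pi * real n / real k)"
    using n(1) pos by (simp add: sin_ge_zero field_simps)
  also have "\<dots> \<le> \<tau>"
  proof (cases "n \<le> k div 2")
    case False
    have "sin (pi * real n / real k) = sin (pi - pi * real n / real k)"
      by simp
    also have "pi - pi * real n / real k = pi * real (k - n) / real k"
      using n(1) pos by (simp add: of_nat_diff field_simps)
    finally show ?thesis
      using le[of "k - n"] False by (simp add: \<tau>_def)
  qed (use le[of n] in \<open>simp add: \<tau>_def\<close>)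
  finally show ?thesis .
qed

lemma norm_V_mult: "v \<in> V \<Longrightarrow> norm (v * z - v * w) = norm (z - w)"
  using V_norm by (simp add: norm_mult flip: right_diff_distrib)

lemma dist_roots_le:
  assumes "v \<in> V" "w \<in> V"
  shows "norm (v - w) \<le> \<tau>"
proof -
  have "norm (v - w) = norm (v * 1 - v * (cnj v * w))"
    using V_cnj_mult[OF assms(1)] by (simp flip: mult.assoc)
  also have "\<dots> \<le> \<tau>"
    unfolding norm_V_mult[OF assms(1)] using dist_one_root_le V_closed assms by blast
  finally show ?thesis .
qed

lemma half_bounds: "pi / 3 \<le> pi * real (k div 2) / real k" "pi * real (k div 2) / real k \<le> pi / 2"
proof -
  have "k \<le> 3 * (k div 2)"
    using k_ge_3 by linarith
  then have "real k \<le> 3 * real (k div 2)"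
    by linarith
  then show "pi / 3 \<le> pi * real (k div 2) / real k"
    using k_ge_3 by (simp add: field_simps)
  have "real (k div 2) \<le> real k / 2"
    by linarith
  then show "pi * real (k div 2) / real k \<le> pi / 2"
    using k_ge_3 by (simp add: field_simps)
qed

text \<open>The triangle is the extreme case, since \<open>k div 2\<close> is at least
  \<open>k / 3\<close>.\<close>

lemma \<tau>_ge: "sqrt 3 \<le> \<tau>"
proof -
  have "sin (pi / 3) \<le> sin (pi * real (k div 2) / real k)"
    using half_bounds pi_gt_zero by (intro sin_monotone_2pi_le) auto
  then show ?thesis
    by (simp add: \<tau>_def sin_60)
qed

lemma \<tau>_sq: "\<tau>\<^sup>2 \<ge> 3" "\<tau> > 1" "\<tau> \<le> 2"
proof -
  show "\<tau>\<^sup>2 \<ge> 3"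
    using power_mono[OF \<tau>_ge, of 2] by simp
  then show "\<tau> > 1"
    by (smt (verit) \<tau>_ge real_sqrt_gt_1_iff)
  show "\<tau> \<le> 2"
    by (simp add: \<tau>_def)
qed

lemma touching_sym: "touching \<tau> V d d' \<Longrightarrow> touching \<tau> V d' d"
  unfolding touching_def by (metis minus_diff_eq norm_minus_commute)

lemma touching_mult:
  assumes "\<zeta> \<in> V" "touching \<tau> V d d'"
  shows "touching \<tau> V (\<zeta> * d) (\<zeta> * d')"
proof -
  obtain v w where vw: "v \<in> V" "w \<in> V" "d - d' = v - w" "norm (v - w) = \<tau>"
    using assms(2) by (auto simp: touching_def)
  have "\<zeta> * d - \<zeta> * d' = \<zeta> * v - \<zeta> * w"
    using vw(3) by (metis right_diff_distrib)
  then show ?thesis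
    unfolding touching_def using vw V_closed(2)[OF assms(1)] norm_V_mult[OF assms(1)] by metis
qed

lemma touching_cnj:
  assumes "touching \<tau> V d d'"
  shows "touching \<tau> V (cnj d) (cnj d')"
proof -
  obtain v w where vw: "v \<in> V" "w \<in> V" "d - d' = v - w" "norm (v - w) = \<tau>"
    using assms by (auto simp: touching_def)
  then have "cnj d - cnj d' = cnj v - cnj w" "norm (cnj v - cnj w) = \<tau>"
    by (metis complex_cnj_diff, metis complex_cnj_diff complex_mod_cnj)
  then show ?thesis
    unfolding touching_def using vw V_closed(3) by blast
qed

text \<open>The relation required of two positions. Equality is included so that it passes to images
  under the dihedral group, where a cell on a wall coincides with its mirror image.\<close>

definition ok :: "complex \<Rightarrow> complex \<Rightarrow> bool" where
  "ok z w \<longleftrightarrow> z = w \<or> touching \<tau> V z w \<or> norm (z - w) > 2"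

lemma ok_mult: "\<zeta> \<in> V \<Longrightarrow> ok z w \<Longrightarrow> ok (\<zeta> * z) (\<zeta> * w)"
  unfolding ok_def using touching_mult norm_V_mult by metis

lemma ok_cnj: "ok z w \<Longrightarrow> ok (cnj z) (cnj w)"
  unfolding ok_def using touching_cnj by (metis complex_cnj_diff complex_mod_cnj)

lemma touching_diff: "z - w = z' - w' \<Longrightarrow> touching \<tau> V z w \<longleftrightarrow> touching \<tau> V z' w'"
  by (simp add: touching_def)

lemma ok_diff: "z - w = z' - w' \<Longrightarrow> ok z w \<longleftrightarrow> ok z' w'"
  unfolding ok_def using touching_diff by (metis eq_iff_diff_eq_0)

lemma ok_sym: "ok z w \<Longrightarrow> ok w z"
  unfolding ok_def using touching_sym by (metis norm_minus_commute)

end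

text \<open>Positions in the chamber between the directions \<open>1\<close> and \<open>\<epsilon>\<close> of the dihedral group. A cell
  on a wall of the chamber is its own mirror image, and the others are too far from the wall to
  meet their mirror image.\<close>

locale chamber_cells = regular_polygon +
  fixes D\<^sub>0 :: "complex set" and R :: real
  assumes finite_D\<^sub>0: "finite D\<^sub>0" and R_pos: "R > 0"
    and wall_1: "z \<in> D\<^sub>0 \<Longrightarrow> Im z = 0 \<or> Im z > 1"
    and wall_\<epsilon>: "z \<in> D\<^sub>0 \<Longrightarrow> Im (z * cnj \<epsilon>) = 0 \<or> Im (z * cnj \<epsilon>) < -1"
    and far: "z \<in> D\<^sub>0 \<Longrightarrow> norm z * sin (pi / real k) > 2"
    and norm_D\<^sub>0: "z \<in> D\<^sub>0 \<Longrightarrow> norm z \<le> R"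
    and dist_D\<^sub>0: "z \<in> D\<^sub>0 \<Longrightarrow> v \<in> V \<Longrightarrow> norm (z - of_real R * v) \<le> \<tau> * R"
    and R_D\<^sub>0: "of_real R \<in> D\<^sub>0" and ex_D\<^sub>0: "\<exists>z\<in>D\<^sub>0. Im (z * cnj \<epsilon>) = 0"
    and separated_D\<^sub>0: "z \<in> D\<^sub>0 \<Longrightarrow> w \<in> D\<^sub>0 \<Longrightarrow> z \<noteq> w \<Longrightarrow> touching \<tau> V z w \<or> norm (z - w) > 2"
    and linked_D\<^sub>0: "z \<in> D\<^sub>0 \<Longrightarrow> (of_real R, z) \<in> {(d, d') \<in> D\<^sub>0 \<times> D\<^sub>0. touching \<tau> V d d'}\<^sup>*"
begin

definition D :: "complex set" where
  "D = (\<Union>\<zeta>\<in>V. (*) \<zeta> ` (D\<^sub>0 \<union> cnj ` D\<^sub>0))"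

lemma D_cases:
  assumes "d \<in> D"
  obtains \<zeta> z where "\<zeta> \<in> V" "z \<in> D\<^sub>0" "d = \<zeta> * z" | \<zeta> z where "\<zeta> \<in> V" "z \<in> D\<^sub>0" "d = \<zeta> * cnj z"
  using assms unfolding D_def by blast

lemma D_I: "\<zeta> \<in> V \<Longrightarrow> z \<in> D\<^sub>0 \<Longrightarrow> \<zeta> * z \<in> D" "\<zeta> \<in> V \<Longrightarrow> z \<in> D\<^sub>0 \<Longrightarrow> \<zeta> * cnj z \<in> D"
  unfolding D_def by blast+

lemma D_mult: "\<zeta> \<in> V \<Longrightarrow> d \<in> D \<Longrightarrow> \<zeta> * d \<in> D"
  by (erule D_cases) (metis D_I V_closed(2) mult.assoc)+

lemma D_cnj: "d \<in> D \<Longrightarrow> cnj d \<in> D"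
  by (erule D_cases) (metis D_I V_closed(3) complex_cnj_mult complex_cnj_cnj)+

lemma ok_D\<^sub>0: "z \<in> D\<^sub>0 \<Longrightarrow> w \<in> D\<^sub>0 \<Longrightarrow> ok z w"
  using separated_D\<^sub>0 by (auto simp: ok_def)

text \<open>\<open>far\<close> excludes 0, and the wall conditions give the signs of
  \<open>sin \<alpha>\<close> and \<open>sin (\<alpha> - pi / k)\<close>, which confine the argument
  to the sector.\<close>

lemma D\<^sub>0_polar:
  assumes "z \<in> D\<^sub>0"
  obtains \<alpha> where "0 \<le> \<alpha>" "\<alpha> \<le> pi / real k" "z = rcis (norm z) \<alpha>"
proof -
  have pos: "norm z > 0" and k: "0 < pi / real k" "pi / real k < pi"
    using far[OF assms] k_ge_3 by (cases "z = 0"; simp add: field_simps)+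
  define \<alpha> where "\<alpha> = Arg z"
  have z: "z = rcis (norm z) \<alpha>"
    by (simp add: \<alpha>_def rcis_cmod_Arg)
  have bd: "- pi < \<alpha>" "\<alpha> \<le> pi"
    using Arg_bounded[of z] by (auto simp: \<alpha>_def)
  have "Im z = norm z * sin \<alpha>"
    by (subst z) simp
  moreover have "Im z \<ge> 0"
    using wall_1[OF assms] by auto
  ultimately have "sin \<alpha> \<ge> 0"
    using pos by (simp add: zero_le_mult_iff)
  have \<alpha>0: "0 \<le> \<alpha>"
  proof (rule ccontr)
    assume "\<not> 0 \<le> \<alpha>"
    then have "sin (- \<alpha>) > 0"
      using bd by (intro sin_gt_zero) auto
    then show False
      using \<open>sin \<alpha> \<ge> 0\<close> by simp
  qed
  have "z * cnj \<epsilon> = rcis (norm z) (\<alpha> - pi / real k)"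
    by (subst z) (simp add: rcis_def cis_cnj cis_mult mult.assoc)
  then have "Im (z * cnj \<epsilon>) = norm z * sin (\<alpha> - pi / real k)"
    by simp
  moreover have "Im (z * cnj \<epsilon>) \<le> 0"
    using wall_\<epsilon>[OF assms] by auto
  ultimately have s: "sin (\<alpha> - pi / real k) \<le> 0"
    using pos by (simp add: mult_le_0_iff)
  have "\<alpha> \<le> pi / real k"
  proof (rule ccontr)
    assume "\<not> \<alpha> \<le> pi / real k"
    then have "sin (\<alpha> - pi / real k) > 0"
      using bd k by (intro sin_gt_zero) auto
    then show False
      using s by simp
  qed
  then show thesis
    using that \<alpha>0 z by blast
qed

text \<open>Arguments that differ by at least \<open>pi / k\<close> modulo \<open>2 * pi\<close>
  suffice, whatever the norm of \<open>w\<close>: \<open>far\<close> bounds the distance of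
  \<open>z\<close> from the ray of \<open>w\<close>.\<close>

lemma far_apart:
  assumes "z \<in> D\<^sub>0" "w = rcis (norm w) \<beta>" "z = rcis (norm z) \<alpha>"
    "pi / real k \<le> \<beta> - \<alpha>" "\<beta> - \<alpha> \<le> 2 * pi - pi / real k"
  shows "norm (z - w) > 2"
proof -
  have k: "0 \<le> pi / real k" "pi / real k \<le> pi"
    using k_ge_3 by (auto simp: field_simps)
  have "cos (\<alpha> - \<beta>) \<le> cos (pi / real k)"
    using cos_le_cos_of_between[OF k(1) assms(4,5)] by (simp add: cos_diff mult.commute)
  then have "norm z * sin (pi / real k) \<le> norm (z - w)"
    using norm_diff_ge_sin[of "norm z" "norm w" "pi / real k" \<alpha> \<beta>] k assms(2,3) by simp
  then show ?thesis
    using far[OF assms(1)] by linarith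
qed

lemma wall_mirror:
  assumes "Im z = 0 \<or> Im z > 1" "Im w = 0 \<or> Im w > 1" "ok z w"
  shows "ok z (cnj w)"
proof -
  consider "Im w = 0" | "Im z = 0" | "Im z > 1" "Im w > 1"
    using assms by blast
  then show ?thesis
  proof cases
    case 1
    then have "cnj w = w"
      by (simp add: complex_eq_iff)
    then show ?thesis
      using assms(3) by simp
  next
    case 2
    then have "cnj z = z"
      by (simp add: complex_eq_iff)
    then show ?thesis
      using ok_cnj[OF assms(3)] by simp
  next
    case 3
    then have "Im (z - cnj w) > 2"
      by simp
    then have "norm (z - cnj w) > 2"
      using abs_Im_le_cmod[of "z - cnj w"] by linarith
    then show ?thesis
      by (simp add: ok_def)
  qed
qed

lemma \<epsilon>_mult: "\<epsilon> * cnj \<epsilon> = 1" "cnj \<epsilon> * \<epsilon> = 1" "vertex 1 = \<epsilon> * \<epsilon>"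
  by (simp_all add: cis_cnj cis_mult)

text \<open>As \<open>vertex 1 = \<epsilon> * \<epsilon>\<close>, the map
  \<open>z \<mapsto> vertex 1 * cnj z\<close> is the reflection in the line through
  \<open>\<epsilon>\<close>.\<close>

lemma mirror_\<epsilon>_eq:
  assumes "Im (z * cnj \<epsilon>) = 0"
  shows "vertex 1 * cnj z = z"
proof -
  have "cnj (z * cnj \<epsilon>) = z * cnj \<epsilon>"
    using assms by (simp add: complex_eq_iff)
  then have *: "cnj z * \<epsilon> = z * cnj \<epsilon>"
    by (simp only: complex_cnj_mult complex_cnj_cnj)
  have "vertex 1 * cnj z = \<epsilon> * (cnj z * \<epsilon>)"
    unfolding \<epsilon>_mult(3) by (simp only: mult_ac)
  also have "\<dots> = z * (\<epsilon> * cnj \<epsilon>)"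
    unfolding * by (simp only: mult_ac)
  finally show ?thesis
    by (simp only: \<epsilon>_mult mult_1_right)
qed

lemma wall_mirror_\<epsilon>:
  assumes "z \<in> D\<^sub>0" "w \<in> D\<^sub>0"
  shows "ok z (vertex 1 * cnj w)"
proof -
  let ?p = "Im (z * cnj \<epsilon>)" and ?q = "Im (w * cnj \<epsilon>)"
  consider "?q = 0" | "?p = 0" | "?p < -1" "?q < -1"
    using wall_\<epsilon> assms by blast
  then show ?thesis
  proof cases
    case 1
    then show ?thesis
      using mirror_\<epsilon>_eq[of w] ok_D\<^sub>0 assms by simp
  next
    case 2
    then show ?thesis
      using mirror_\<epsilon>_eq[of z] ok_mult[OF vertex_V ok_cnj[OF ok_D\<^sub>0[OF assms]], of 1] by simp
  next
    case 3
    have "(z - vertex 1 * cnj w) * cnj \<epsilon> = z * cnj \<epsilon> - cnj (w * cnj \<epsilon>) * (\<epsilon> * cnj \<epsilon>)"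
      unfolding \<epsilon>_mult(3) by (simp add: algebra_simps)
    then have "Im ((z - vertex 1 * cnj w) * cnj \<epsilon>) = ?p + ?q"
      by (simp add: \<epsilon>_mult)
    then have "norm ((z - vertex 1 * cnj w) * cnj \<epsilon>) > 2"
      using abs_Im_le_cmod[of "(z - vertex 1 * cnj w) * cnj \<epsilon>"] 3 by linarith
    then show ?thesis
      by (simp add: ok_def norm_mult)
  qed
qed

text \<open>Only two other chambers share a wall with the given one, namely its images under
  \<open>cnj\<close> and under \<open>z \<mapsto> vertex 1 * cnj z\<close>. All remaining chambers
  are at angular distance at least \<open>pi / k\<close>, where \<open>far_apart\<close>
  applies.\<close>

lemma ok_D\<^sub>0_D:
  assumes "z \<in> D\<^sub>0" "d \<in> D"
  shows "ok z d"
proof -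
  obtain \<alpha> where \<alpha>: "0 \<le> \<alpha>" "\<alpha> \<le> pi / real k" "z = rcis (norm z) \<alpha>"
    using D\<^sub>0_polar[OF assms(1)] by blast
  define \<gamma> where "\<gamma> n = 2 * pi * real n / real k" for n
  define \<delta> where "\<delta> = pi / real k"
  have turn: "\<delta> * 2 \<le> \<gamma> n" if "n \<ge> 1" for n
    using that k_ge_3 by (simp add: \<gamma>_def \<delta>_def field_simps)
  have turn2: "\<delta> * 4 \<le> \<gamma> n" if "n \<ge> 2" for n
    using that k_ge_3 by (simp add: \<gamma>_def \<delta>_def field_simps)
  have gap: "\<gamma> n \<le> 2 * pi - \<delta> * 2" if "n < k" for n
  proof -
    have "real n + 1 \<le> real k"
      using that by linarith
    then have "2 * pi * (real n + 1) \<le> 2 * pi * real k"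
      by simp
    then show ?thesis
      using k_ge_3 by (simp add: \<gamma>_def \<delta>_def field_simps)
  qed
  from assms(2) show ?thesis
  proof (cases rule: D_cases)
    case (1 \<zeta> w)
    obtain n where n: "n < k" "\<zeta> = vertex n"
      using 1(1) V_eq by auto
    obtain \<beta> where \<beta>: "0 \<le> \<beta>" "\<beta> \<le> pi / real k" "w = rcis (norm w) \<beta>"
      using D\<^sub>0_polar[OF 1(2)] by blast
    have d: "norm d = norm w"
      using 1 V_norm by (simp add: norm_mult)
    show ?thesis
    proof (cases "n = 0")
      case True
      then show ?thesis
        using 1 n ok_D\<^sub>0 assms(1) by simp
    next
      case False
      then have n1: "n \<ge> 1"
        by simp
      have "d = rcis (norm w) (\<gamma> n + \<beta>)"
        unfolding \<gamma>_def 1(3) n(2) by (subst \<beta>(3)) (simp add: rcis_def mult.left_commute cis_mult)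
      then have "norm (z - d) > 2"
        unfolding d[symmetric]
        by (rule far_apart[OF assms(1) _ \<alpha>(3)]) (use turn[OF n1] gap[OF n(1)] \<alpha>(1,2) \<beta>(1,2) in \<open>simp_all flip: \<delta>_def\<close>)
      then show ?thesis
        by (simp add: ok_def)
    qed
  next
    case (2 \<zeta> w)
    obtain n where n: "n < k" "\<zeta> = vertex n"
      using 2(1) V_eq by auto
    obtain \<beta> where \<beta>: "0 \<le> \<beta>" "\<beta> \<le> pi / real k" "w = rcis (norm w) \<beta>"
      using D\<^sub>0_polar[OF 2(2)] by blast
    have d: "norm d = norm w"
      using 2 V_norm by (simp add: norm_mult)
    consider "n = 0" | "n = 1" | "n \<ge> 2"
      by linarith
    then show ?thesis
    proof cases
      case 1
      then show ?thesis
        using wall_mirror[of z w] wall_1 ok_D\<^sub>0 assms(1) 2 n by simp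
    next
      case 2
      then show ?thesis
        using wall_mirror_\<epsilon> assms(1) \<open>w \<in> D\<^sub>0\<close> \<open>d = \<zeta> * cnj w\<close> n by simp
    next
      case 3
      have "d = rcis (norm w) (\<gamma> n - \<beta>)"
        unfolding \<gamma>_def 2(3) n(2)
        by (subst \<beta>(3)) (simp add: rcis_def mult.left_commute cis_mult cis_cnj)
      then have "norm (z - d) > 2"
        unfolding d[symmetric]
        by (rule far_apart[OF assms(1) _ \<alpha>(3)]) (use turn2[OF 3] gap[OF n(1)] \<alpha>(1,2) \<beta>(1,2) in \<open>simp_all flip: \<delta>_def\<close>)
      then show ?thesis
        by (simp add: ok_def)
    qed
  qed
qed

text \<open>A symmetry brings the first cell into the chamber.\<close>

lemma ok_D:
  assumes "d \<in> D" "d' \<in> D"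
  shows "ok d d'"
  using assms(1)
proof (cases rule: D_cases)
  case (1 \<zeta> z)
  have "ok (\<zeta> * z) (\<zeta> * (cnj \<zeta> * d'))"
    using 1 V_closed D_mult assms(2) by (intro ok_mult ok_D\<^sub>0_D) auto
  then show ?thesis
    using 1 V_cnj_mult by (simp flip: mult.assoc)
next
  case (2 \<zeta> z)
  have "ok (\<zeta> * cnj z) (\<zeta> * cnj (cnj (cnj \<zeta> * d')))"
    using 2 V_closed D_mult D_cnj assms(2) by (intro ok_mult ok_cnj ok_D\<^sub>0_D) auto
  then show ?thesis
    using 2 V_cnj_mult by (simp flip: mult.assoc)
qed

abbreviation "E \<equiv> {(d, d') \<in> D \<times> D. touching \<tau> V d d'}"

lemma sym_E: "(d, d') \<in> E\<^sup>* \<Longrightarrow> (d', d) \<in> E\<^sup>*"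
proof -
  have "sym E"
    using touching_sym by (auto simp: sym_def)
  then show "(d, d') \<in> E\<^sup>* \<Longrightarrow> (d', d) \<in> E\<^sup>*"
    by (meson sym_rtrancl symD)
qed

lemma E_mult: "\<zeta> \<in> V \<Longrightarrow> (d, d') \<in> E\<^sup>* \<Longrightarrow> (\<zeta> * d, \<zeta> * d') \<in> E\<^sup>*"
  by (erule rtrancl_image) (use D_mult touching_mult in auto)

lemma E_cnj: "(d, d') \<in> E\<^sup>* \<Longrightarrow> (cnj d, cnj d') \<in> E\<^sup>*"
  by (erule rtrancl_image) (use D_cnj touching_cnj in auto)

lemma linked_chamber:
  assumes "z \<in> D\<^sub>0"
  shows "(of_real R, z) \<in> E\<^sup>*"
proof -
  have "D\<^sub>0 \<subseteq> D"
    using D_I(1)[OF V_closed(1)] by auto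
  then have "{(d, d') \<in> D\<^sub>0 \<times> D\<^sub>0. touching \<tau> V d d'} \<subseteq> E"
    by blast
  then show ?thesis
    using linked_D\<^sub>0[OF assms] rtrancl_mono by blast
qed

lemma linked_corner: "(of_real R, vertex n * of_real R) \<in> E\<^sup>*"
proof (induction n)
  case (Suc n)
  obtain b where b: "b \<in> D\<^sub>0" "Im (b * cnj \<epsilon>) = 0"
    using ex_D\<^sub>0 by blast
  \<comment> \<open>The reflection in the wall fixes \<open>b\<close> and exchanges the corners
    \<open>R\<close> and \<open>vertex 1 * R\<close>. It turns the path from \<open>R\<close> to
    \<open>b\<close> into one from the next corner to \<open>b\<close>.\<close>
  have "vertex 1 * cnj b = b"
    by (rule mirror_\<epsilon>_eq[OF b(2)])
  then have "(vertex 1 * of_real R, b) \<in> E\<^sup>*"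
    using E_mult[OF vertex_V E_cnj[OF linked_chamber[OF b(1)]], of 1] by simp
  then have "(of_real R, vertex 1 * of_real R) \<in> E\<^sup>*"
    using rtrancl_trans[OF linked_chamber[OF b(1)] sym_E] by blast
  then have "(vertex n * of_real R, vertex n * (vertex 1 * of_real R)) \<in> E\<^sup>*"
    by (rule E_mult[OF vertex_V])
  moreover have "vertex n * vertex 1 = vertex (Suc n)"
    unfolding cis_mult by (simp add: add_divide_distrib distrib_left add.commute)
  ultimately show ?case
    using rtrancl_trans[OF Suc.IH] by (simp add: mult.assoc[symmetric])
qed simp

lemma linked_D: "d \<in> D \<Longrightarrow> (of_real R, d) \<in> E\<^sup>*"
proof (erule D_cases)
  fix \<zeta> z assume \<zeta>: "\<zeta> \<in> V" and z: "z \<in> D\<^sub>0"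
  have *: "(of_real R, \<zeta> * of_real R) \<in> E\<^sup>*"
    using linked_corner \<zeta> unfolding V_eq by blast
  show "(of_real R, d) \<in> E\<^sup>*" if "d = \<zeta> * z"
    unfolding that by (rule rtrancl_trans[OF * E_mult[OF \<zeta> linked_chamber[OF z]]])
  show "(of_real R, d) \<in> E\<^sup>*" if "d = \<zeta> * cnj z"
    unfolding that
    using rtrancl_trans[OF *] E_mult[OF \<zeta> E_cnj[OF linked_chamber[OF z]]]
    by (simp only: complex_cnj_complex_of_real)
qed

lemma pattern: "cell_pattern V D \<tau> R"
proof
  show "finite V" "finite D" "2 \<le> card V" "0 < R" "1 < \<tau>"
    using finite_roots finite_D\<^sub>0 card_V_eq k_ge_3 R_pos \<tau>_sq by (auto simp: D_def)
  show "norm v = 1" if "v \<in> V" for v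
    using that by (rule V_norm)
  show "norm (v - w) \<le> \<tau>" if "v \<in> V" "w \<in> V" for v w
    using that by (rule dist_roots_le)
  show "norm d \<le> R" if "d \<in> D" for d
    using that by (cases rule: D_cases) (auto simp: norm_mult V_norm norm_D\<^sub>0)
  show "norm (d - R *\<^sub>R v) \<le> \<tau> * R" if "d \<in> D" "v \<in> V" for d v
    using that(1)
  proof (cases rule: D_cases)
    case (1 \<zeta> z)
    have "d - R *\<^sub>R v = \<zeta> * z - \<zeta> * (of_real R * (cnj \<zeta> * v))"
      using V_cnj_mult[OF 1(1)] 1(3) by (simp add: scaleR_conv_of_real mult.left_commute[of \<zeta>] flip: mult.assoc)
    then have "norm (d - R *\<^sub>R v) = norm (z - of_real R * (cnj \<zeta> * v))"
      by (simp only: norm_V_mult[OF 1(1)])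
    also have "\<dots> \<le> \<tau> * R"
      using 1 that(2) V_closed by (intro dist_D\<^sub>0) auto
    finally show ?thesis .
  next
    case (2 \<zeta> z)
    have "d - R *\<^sub>R v = \<zeta> * cnj z - \<zeta> * cnj (of_real R * (\<zeta> * cnj v))"
      using V_cnj_mult[OF 2(1)] 2(3) by (simp add: scaleR_conv_of_real mult.left_commute[of \<zeta>] flip: mult.assoc)
    then have "norm (d - R *\<^sub>R v) = norm (cnj z - cnj (of_real R * (\<zeta> * cnj v)))"
      by (simp only: norm_V_mult[OF 2(1)])
    also have "\<dots> = norm (z - of_real R * (\<zeta> * cnj v))"
      by (metis complex_cnj_diff complex_mod_cnj)
    also have "\<dots> \<le> \<tau> * R"
      using 2 that(2) V_closed by (intro dist_D\<^sub>0) auto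
    finally show ?thesis .
  qed
  show "R *\<^sub>R v \<in> D" if "v \<in> V" for v
    using D_I(1)[OF that R_D\<^sub>0] by (simp add: scaleR_conv_of_real mult.commute)
  show "touching \<tau> V d d' \<or> 2 < norm (d - d')" if "d \<in> D" "d' \<in> D" "d \<noteq> d'" for d d'
    using ok_D[OF that(1,2)] that(3) by (simp add: ok_def)
  show "bisector_reflection x y ` V = V" if "x \<in> V" "y \<in> V" "x \<noteq> y" for x y
  proof -
    have refl: "bisector_reflection x y z = x * y * cnj z" for z
      using that V_norm by (intro bisector_reflection_complex) auto
    have "x * y * cnj (x * y * cnj v) = v" if "v \<in> V" for v
    proof -
      have "x * y * cnj (x * y * cnj v) = (x * cnj x) * (y * cnj y) * v"
        by (simp add: mult_ac)
      then show ?thesis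
        using V_cnj_mult \<open>x \<in> V\<close> \<open>y \<in> V\<close> by simp
    qed
    moreover have "x * y * cnj v \<in> V" if "v \<in> V" for v
      using that \<open>x \<in> V\<close> \<open>y \<in> V\<close> V_closed by blast
    ultimately show ?thesis
      unfolding refl by (intro equalityI subsetI) (force, metis imageI)
  qed
  show "bisector_reflection x y d \<in> D" if "x \<in> V" "y \<in> V" "x \<noteq> y" "d \<in> D" for x y d
  proof -
    have "bisector_reflection x y d = x * y * cnj d"
      using that V_norm by (intro bisector_reflection_complex) auto
    then show ?thesis
      using D_mult[OF V_closed(2)[OF that(1,2)] D_cnj[OF that(4)]] by simp
  qed
  show "(d, d') \<in> E\<^sup>*" if "d \<in> D" "d' \<in> D" for d d'
    using rtrancl_trans[OF sym_E[OF linked_D[OF that(1)]] linked_D[OF that(2)]] .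
qed

end

section \<open>Long chains\<close>

text \<open>A chain of cells with step \<open>t\<close> from the corner \<open>R\<close> to the wall of direction \<open>\<epsilon>\<close>, which is
  interrupted in the middle by a cluster \<open>Q\<close> of cells. The chain is attached to the cluster at
  the elements \<open>0\<close> and \<open>\<delta>\<close> that are extreme in the direction \<open>t\<close>.\<close>

locale interrupted_chain = regular_polygon +
  fixes t \<delta> :: complex and Q :: "complex set"
  assumes t_touching: "touching \<tau> V t 0"
    and Im_t: "Im t > 1" and Im_t_\<epsilon>: "Im (t * cnj \<epsilon>) > 1" and Re_t_\<epsilon>: "Re (t * cnj \<epsilon>) \<le> 0"
    and finite_Q: "finite Q" and Q_0: "0 \<in> Q" and Q_\<delta>: "\<delta> \<in> Q"
    and ok_Q: "x \<in> Q \<Longrightarrow> y \<in> Q \<Longrightarrow> ok x y"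
    and extreme_0: "x \<in> Q \<Longrightarrow> x \<bullet> t \<ge> 0" and extreme_\<delta>: "x \<in> Q \<Longrightarrow> (\<delta> - x) \<bullet> t \<ge> 0"
    and linked_Q: "x \<in> Q \<Longrightarrow> (0, x) \<in> {(d, d') \<in> Q \<times> Q. touching \<tau> V d d'}\<^sup>*"
begin

lemma norm_t: "norm t = \<tau>"
  using t_touching by (auto simp: touching_def)

lemma ok_multiple: "ok (of_nat j * t) 0"
proof -
  consider "j = 0" | "j = 1" | "j \<ge> 2"
    by linarith
  then show ?thesis
  proof cases
    case 3
    then have le: "2 * \<tau> \<le> real j * \<tau>"
      using \<tau>_sq by (intro mult_right_mono) auto
    have "norm (of_nat j * t) = real j * \<tau>"
      by (simp add: norm_mult norm_t)
    then have "norm (of_nat j * t) > 2"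
      using le \<tau>_sq(2) by linarith
    then show ?thesis
      by (simp add: ok_def)
  qed (use t_touching in \<open>auto simp: ok_def\<close>)
qed

lemma ok_multiples: "ok (of_nat i * t) (of_nat j * t)"
proof (cases "i \<le> j")
  case True
  have "ok 0 (of_nat (j - i) * t)"
    by (rule ok_sym[OF ok_multiple])
  then show ?thesis
    using True by (subst ok_diff[of _ _ 0 "of_nat (j - i) * t"]) (auto simp: of_nat_diff algebra_simps)
next
  case False
  then show ?thesis
    using ok_multiple[of "i - j"]
    by (subst ok_diff[of _ _ "of_nat (i - j) * t" 0]) (auto simp: of_nat_diff algebra_simps)
qed

text \<open>The shift does not lean back towards \<open>y\<close>, so the squares add up:
  \<open>norm (x - y)\<close> and \<open>norm (j * t)\<close> are both at least
  \<open>\<tau>\<close>, and \<open>3 + 3 > 4\<close>. The extremality of \<open>0\<close> and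
  \<open>\<delta>\<close> supplies the sign when an arm of the chain is compared with the cluster or
  with the other arm.\<close>

lemma ok_shift:
  assumes "x \<in> Q" "y \<in> Q" "(x - y) \<bullet> t \<ge> 0"
  shows "ok (x + of_nat j * t) y"
proof -
  consider "j = 0" | "x = y" | "j \<ge> 1" "x \<noteq> y"
    by linarith
  then show ?thesis
  proof cases
    case 1
    then show ?thesis
      using ok_Q assms by simp
  next
    case 2
    then show ?thesis
      using ok_multiple[of j] by (subst ok_diff[of _ _ "of_nat j * t" 0]) auto
  next
    case 3
    have "norm (x - y) \<ge> \<tau>"
      using ok_Q[OF assms(1,2)] 3(2) \<tau>_sq by (auto simp: ok_def touching_def)
    then have "\<tau> ^ 2 \<le> norm (x - y) ^ 2"
      using \<tau>_sq(2) by (intro power_mono) auto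
    then have xy: "norm (x - y) ^ 2 \<ge> 3"
      using \<tau>_sq(1) by linarith
    have j: "1 * 3 \<le> real j ^ 2 * \<tau> ^ 2"
      using 3(1) \<tau>_sq by (intro mult_mono) auto
    have "norm (u + c *\<^sub>R t) ^ 2 = norm u ^ 2 + 2 * (c * (u \<bullet> t)) + c ^ 2 * norm t ^ 2" for u c
      unfolding power2_norm_eq_inner power2_eq_square[of c]
      by (simp add: inner_add_left inner_add_right inner_commute algebra_simps)
    then have "norm (x - y + real j *\<^sub>R t) ^ 2
        = norm (x - y) ^ 2 + 2 * (real j * ((x - y) \<bullet> t)) + real j ^ 2 * norm t ^ 2" .
    also have "\<dots> \<ge> 3 + 0 + 3"
      using xy j assms(3) by (intro add_mono) (auto simp: norm_t)
    finally have "2 ^ 2 < norm (x - y + real j *\<^sub>R t) ^ 2"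
      by simp
    then have "2 < norm (x - y + real j *\<^sub>R t)"
      by (rule power2_less_imp_less) simp
    then show ?thesis
      by (simp add: ok_def scaleR_conv_of_real algebra_simps)
  qed
qed

definition before :: "nat \<Rightarrow> complex set" where
  "before M = (\<lambda>j. - (of_nat j * t)) ` {..M}"

definition after :: "nat \<Rightarrow> complex set" where
  "after M = (\<lambda>j. \<delta> + of_nat j * t) ` {..M}"

lemma ok_before: "x \<in> before M \<Longrightarrow> y \<in> before M \<Longrightarrow> ok x y"
proof -
  assume "x \<in> before M" "y \<in> before M"
  then obtain i j where ij: "x = - (of_nat i * t)" "y = - (of_nat j * t)"
    by (auto simp: before_def)
  then have "x - y = of_nat j * t - of_nat i * t"
    by simp
  then show ?thesis
    using ok_diff ok_multiples by metis
qed

lemma ok_after: "x \<in> after M \<Longrightarrow> y \<in> after M \<Longrightarrow> ok x y"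
proof -
  assume "x \<in> after M" "y \<in> after M"
  then obtain i j where ij: "x = \<delta> + of_nat i * t" "y = \<delta> + of_nat j * t"
    by (auto simp: after_def)
  then have "x - y = of_nat i * t - of_nat j * t"
    by simp
  then show ?thesis
    using ok_diff ok_multiples by metis
qed

lemma ok_before_Q: "x \<in> before M \<Longrightarrow> y \<in> Q \<Longrightarrow> ok y x"
proof -
  assume "x \<in> before M" and y: "y \<in> Q"
  then obtain j where "x = - (of_nat j * t)"
    by (auto simp: before_def)
  then have "y - x = y + of_nat j * t - 0"
    by simp
  then show ?thesis
    using ok_diff ok_shift[OF y Q_0] extreme_0[OF y] by (metis diff_zero)
qed

lemma ok_after_Q: "x \<in> after M \<Longrightarrow> y \<in> Q \<Longrightarrow> ok x y"
  using ok_shift[OF Q_\<delta>] extreme_\<delta> by (auto simp: after_def)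

lemma ok_after_before: "x \<in> after M \<Longrightarrow> y \<in> before M \<Longrightarrow> ok x y"
proof -
  assume "x \<in> after M" "y \<in> before M"
  then obtain i j where "x = \<delta> + of_nat i * t" "y = - (of_nat j * t)"
    by (auto simp: before_def after_def)
  then have "x - y = \<delta> + of_nat (i + j) * t - 0"
    by (simp add: algebra_simps)
  then show ?thesis
    using ok_diff ok_shift[OF Q_\<delta> Q_0] extreme_0[OF Q_\<delta>] by (metis diff_zero)
qed

definition cells :: "nat \<Rightarrow> complex set" where
  "cells M = before M \<union> Q \<union> after M"

lemma ok_cells: "x \<in> cells M \<Longrightarrow> y \<in> cells M \<Longrightarrow> ok x y"
  unfolding cells_def
  using ok_before ok_after ok_Q ok_before_Q ok_after_Q ok_after_before ok_sym by (metis UnE)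

lemma linked_cells:
  assumes "x \<in> cells M"
  shows "(- (of_nat M * t), x) \<in> {(d, d') \<in> cells M \<times> cells M. touching \<tau> V d d'}\<^sup>*" (is "_ \<in> ?E\<^sup>*")
proof -
  have step: "touching \<tau> V z (z + t)" for z
    using touching_sym[OF t_touching] touching_diff[of 0 t z "z + t"] by simp
  have b: "(- (of_nat M * t), - (of_nat M * t) + of_nat j * t) \<in> ?E\<^sup>*" if "j \<le> M" for j
    using that
  proof (induction j)
    case (Suc j)
    have mem: "- (of_nat M * t) + of_nat i * t \<in> cells M" if "i \<le> M" for i
    proof -
      have "- (of_nat M * t) + of_nat i * t = - (of_nat (M - i) * t)"
        using that by (simp add: of_nat_diff algebra_simps)
      then show ?thesis
        by (auto simp: cells_def before_def)
    qed
    have "- (of_nat M * t) + of_nat (Suc j) * t = - (of_nat M * t) + of_nat j * t + t"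
      by (simp add: algebra_simps)
    then have tch: "touching \<tau> V (- (of_nat M * t) + of_nat j * t) (- (of_nat M * t) + of_nat (Suc j) * t)"
      by (simp only: step)
    have "(- (of_nat M * t) + of_nat j * t, - (of_nat M * t) + of_nat (Suc j) * t) \<in> ?E"
      by (intro CollectI case_prodI conjI SigmaI mem tch) (use Suc.prems in simp_all)
    then show ?case
      using Suc by (meson Suc_leD rtrancl_into_rtrancl)
  qed simp
  from b[of M] have b0: "(- (of_nat M * t), 0) \<in> ?E\<^sup>*"
    by simp
  have q: "(- (of_nat M * t), y) \<in> ?E\<^sup>*" if "y \<in> Q" for y
  proof -
    have "{(d, d') \<in> Q \<times> Q. touching \<tau> V d d'} \<subseteq> ?E"
      by (auto simp: cells_def)
    then have "(0, y) \<in> ?E\<^sup>*"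
      using linked_Q[OF that] rtrancl_mono by blast
    then show ?thesis
      using b0 by (rule rtrancl_trans[rotated])
  qed
  have a: "(- (of_nat M * t), \<delta> + of_nat j * t) \<in> ?E\<^sup>*" if "j \<le> M" for j
    using that
  proof (induction j)
    case 0
    then show ?case
      using q[OF Q_\<delta>] by simp
  next
    case (Suc j)
    have mem: "\<delta> + of_nat i * t \<in> cells M" if "i \<le> M" for i
      using that by (auto simp: cells_def after_def)
    have "\<delta> + of_nat (Suc j) * t = \<delta> + of_nat j * t + t"
      by (simp add: algebra_simps)
    then have tch: "touching \<tau> V (\<delta> + of_nat j * t) (\<delta> + of_nat (Suc j) * t)"
      by (simp only: step)
    have "(\<delta> + of_nat j * t, \<delta> + of_nat (Suc j) * t) \<in> ?E"
      by (intro CollectI case_prodI conjI SigmaI mem tch) (use Suc.prems in simp_all)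
    then show ?case
      using Suc by (meson Suc_leD rtrancl_into_rtrancl)
  qed
  have "(- (of_nat M * t), - (of_nat j * t)) \<in> ?E\<^sup>*" if "j \<le> M" for j
  proof -
    have "- (of_nat M * t) + of_nat (M - j) * t = - (of_nat j * t)"
      using that by (simp add: of_nat_diff algebra_simps)
    then show ?thesis
      using b[of "M - j"] by simp
  qed
  then show ?thesis
    using assms a q by (auto simp: cells_def before_def after_def)
qed

end

text \<open>Strict convexity of the ball, by the parallelogram law. It moves points from the
  boundary of the admissible region into its interior.\<close>

lemma norm_midpoint_less:
  fixes x y :: "'a::real_inner"
  assumes "norm x \<le> r" "norm y \<le> r" "x \<noteq> y"
  shows "norm ((x + y) /\<^sub>R 2) < r"
proof -
  have "norm (x + y) ^ 2 + norm (x - y) ^ 2 = 2 * norm x ^ 2 + 2 * norm y ^ 2"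
    by (simp add: power2_norm_eq_inner inner_simps inner_commute)
  moreover have "norm x ^ 2 \<le> r ^ 2" "norm y ^ 2 \<le> r ^ 2"
    using assms by (simp_all add: power_mono)
  moreover have "norm (x - y) ^ 2 > 0"
    using assms(3) by simp
  ultimately have "norm (x + y) ^ 2 < 4 * r ^ 2"
    by linarith
  then have "norm (x + y) ^ 2 < (2 * r) ^ 2"
    by (simp add: power_mult_distrib)
  then have "norm (x + y) < 2 * r"
    by (rule power2_less_imp_less) (use norm_ge_zero[of x] assms(1) in linarith)
  then show ?thesis
    by simp
qed

section \<open>Asymptotics of long chains\<close>

context interrupted_chain
begin

definition s :: real where "s = sin (pi / real k)"

definition \<beta> :: real where "\<beta> = Im (t * cnj \<epsilon>)"

definition b :: real where "b = Im (\<delta> * cnj \<epsilon>)"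

text \<open>The size for which the chain ends on the wall.\<close>

definition R :: "nat \<Rightarrow> real" where
  "R M = (2 * real M * \<beta> + b) / s"

text \<open>The limit of the far end of the chain after division by \<open>R M\<close>: the point
  where the ray from 1 in direction \<open>t\<close> meets the line through
  \<open>\<epsilon>\<close>. Its distance from 0 is \<open>\<rho>\<close>.\<close>

definition endpoint :: complex where
  "endpoint = 1 + of_real (s / \<beta>) * t"

definition \<rho> :: real where "\<rho> = Im t / \<beta>"

lemma basic_pos: "s > 0" "\<beta> > 1" "\<rho> > 0" "cos (pi / real k) < 1"
proof -
  have k: "0 < pi / real k" "pi / real k < pi"
    using k_ge_3 by (simp_all add: field_simps)
  show "s > 0"
    unfolding s_def using k by (rule sin_gt_zero)
  show "\<beta> > 1" "\<rho> > 0"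
    using Im_t Im_t_\<epsilon> by (simp_all add: \<beta>_def \<rho>_def)
  show "cos (pi / real k) < 1"
    using cos_monotone_0_pi[of 0 "pi / real k"] k by simp
qed

text \<open>\<open>cos (pi / k)\<close> is the coordinate of 1 along \<open>\<epsilon>\<close>, and
  by \<open>Re_t_\<epsilon>\<close> the ray does not advance in that direction. So the endpoint lies
  no farther out than the midpoint of the edge from 1 to \<open>vertex 1\<close>.\<close>

lemma endpoint_eq: "endpoint = of_real \<rho> * \<epsilon>" and \<rho>_le: "\<rho> \<le> cos (pi / real k)"
proof -
  have t: "t = (t * cnj \<epsilon>) * \<epsilon>"
    by (simp add: mult.assoc cis_cnj cis_mult)
  have Im_t: "Im t = Re (t * cnj \<epsilon>) * s + \<beta> * cos (pi / real k)"
    by (subst t) (simp only: times_complex.simps cis.simps s_def \<beta>_def)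
  have \<rho>: "\<rho> = cos (pi / real k) + s / \<beta> * Re (t * cnj \<epsilon>)"
    unfolding \<rho>_def Im_t using basic_pos by (simp add: field_simps)
  have e: "endpoint * cnj \<epsilon> = cnj \<epsilon> + of_real (s / \<beta>) * (t * cnj \<epsilon>)"
    by (simp add: endpoint_def algebra_simps)
  have re: "Re (a + of_real c * z) = Re a + c * Re z" and im: "Im (a + of_real c * z) = Im a + c * Im z"
    for a z c
    by simp_all
  have "Re (endpoint * cnj \<epsilon>) = \<rho>"
    unfolding e re \<rho> by (simp only: cnj.sel cis.sel)
  moreover have "Im (endpoint * cnj \<epsilon>) = 0"
    unfolding e im \<beta>_def[symmetric] using basic_pos by (simp add: s_def)
  ultimately have "endpoint * cnj \<epsilon> = of_real \<rho>"
    by (intro complex_eqI) (simp_all only: Re_complex_of_real Im_complex_of_real)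
  then have "endpoint * (cnj \<epsilon> * \<epsilon>) = of_real \<rho> * \<epsilon>"
    by (simp only: mult.assoc[symmetric])
  then show "endpoint = of_real \<rho> * \<epsilon>"
    by (simp add: cis_cnj cis_mult)
  have "s / \<beta> * Re (t * cnj \<epsilon>) \<le> 0"
    using basic_pos Re_t_\<epsilon> by (intro mult_nonneg_nonpos) auto
  then show "\<rho> \<le> cos (pi / real k)"
    using \<rho> by linarith
qed

text \<open>Strict inequalities make the set open, so that a limit in it carries over to all large
  \<open>M\<close>. The last one keeps cells away from 0; half of \<open>\<rho>\<close> leaves a
  margin for \<open>endpoint\<close>, which is at distance \<open>\<rho>\<close>.\<close>

definition good :: "complex set" where
  "good = {z. norm z < 1 \<and> (\<forall>v\<in>V. norm (z - v) < \<tau>) \<and> Re (z * cnj \<epsilon>) > \<rho> / 2}"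

lemma open_good: "open good"
proof -
  have "good = {z. norm z < 1} \<inter> (\<Inter>v\<in>V. {z. norm (z - v) < \<tau>}) \<inter> {z. \<rho> / 2 < Re (z * cnj \<epsilon>)}"
    by (auto simp: good_def)
  also have "open \<dots>"
    using finite_roots by (intro open_Int open_INT ballI open_Collect_less continuous_intros) auto
  finally show ?thesis .
qed

text \<open>The endpoint lies between 0 and the midpoint of an edge. The midpoint is closer than
  \<open>\<tau>\<close> to every vertex by strict convexity, and 0 has distance
  \<open>1 < \<tau>\<close>, so their convex combination with weight \<open>\<mu>\<close> is closer
  than \<open>\<tau>\<close> too.\<close>

lemma endpoint_good: "endpoint \<in> good"
proof -
  let ?C = "cos (pi / real k)"
  have C: "0 < ?C"
    using basic_pos \<rho>_le by linarith
  have "vertex 1 = \<epsilon> * \<epsilon>"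
    by (simp add: cis_mult)
  then have "(1 + vertex 1) /\<^sub>R 2 = of_real ?C * \<epsilon>"
  proof -
    have "1 + \<epsilon> * \<epsilon> = \<epsilon> * (cnj \<epsilon> + \<epsilon>)"
      by (simp add: algebra_simps cis_cnj cis_mult)
    also have "cnj \<epsilon> + \<epsilon> = of_real (2 * ?C)"
      by (simp add: complex_eq_iff)
    finally show ?thesis
      using \<open>vertex 1 = \<epsilon> * \<epsilon>\<close> by (simp add: scaleR_conv_of_real)
  qed
  then have mid: "endpoint = of_real (\<rho> / ?C) * ((1 + vertex 1) /\<^sub>R 2)"
    using C by (simp add: endpoint_eq)
  define \<mu> where "\<mu> = \<rho> / ?C"
  have \<mu>: "0 < \<mu>" "\<mu> \<le> 1"
    using C basic_pos \<rho>_le by (simp_all add: \<mu>_def)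
  have "norm (endpoint - v) < \<tau>" if v: "v \<in> V" for v
  proof -
    have ne: "1 - v \<noteq> vertex 1 - v"
    proof
      assume "1 - v = vertex 1 - v"
      then have "cos (2 * pi * real 1 / real k) = 1"
        by (simp add: complex_eq_iff)
      moreover have "cos (2 * pi * real 1 / real k) < cos 0"
        using k_ge_3 by (intro cos_monotone_0_pi) (auto simp: field_simps)
      ultimately show False
        by simp
    qed
    have "norm ((1 - v + (vertex 1 - v)) /\<^sub>R 2) < \<tau>"
      by (rule norm_midpoint_less[OF dist_roots_le[OF V_closed(1) v] dist_roots_le[OF vertex_V v] ne])
    also have "(1 - v + (vertex 1 - v)) /\<^sub>R 2 = (1 + vertex 1) /\<^sub>R 2 - v"
      by (simp add: scaleR_conv_of_real field_simps)
    finally have m: "norm ((1 + vertex 1) /\<^sub>R 2 - v) < \<tau>" .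
    have "endpoint - v = of_real \<mu> * ((1 + vertex 1) /\<^sub>R 2 - v) + of_real (1 - \<mu>) * (- v)"
      unfolding mid \<mu>_def[symmetric] by (simp add: algebra_simps)
    then have "norm (endpoint - v) \<le> norm (of_real \<mu> * ((1 + vertex 1) /\<^sub>R 2 - v)) + norm (of_real (1 - \<mu>) * (- v))"
      by (simp only: norm_triangle_ineq)
    also have "\<dots> = \<mu> * norm ((1 + vertex 1) /\<^sub>R 2 - v) + (1 - \<mu>) * 1"
      using \<mu> V_norm[OF v] by (simp only: norm_mult norm_of_real norm_minus_cancel abs_of_pos abs_of_nonneg diff_ge_0_iff_ge)
    also have "\<dots> < \<mu> * \<tau> + (1 - \<mu>) * \<tau>"
      using \<mu> m \<tau>_sq(2) by (intro add_less_le_mono mult_strict_left_mono mult_left_mono) auto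
    finally show ?thesis
      by (simp add: algebra_simps)
  qed
  moreover have "norm endpoint < 1"
    using basic_pos \<rho>_le by (simp add: endpoint_eq norm_mult)
  moreover have "endpoint * cnj \<epsilon> = of_real \<rho>"
    by (simp add: endpoint_eq mult.assoc cis_cnj cis_mult)
  ultimately show ?thesis
    using basic_pos by (simp add: good_def del: times_complex.sel)
qed

text \<open>The limit of the rescaled cluster, halfway between 1 and \<open>endpoint\<close>. The
  point 1 is on the boundary of the admissible region, but its midpoint with an interior point is
  inside.\<close>

lemma quarter_good: "1 + of_real (s / (2 * \<beta>)) * t \<in> good"
proof -
  have q: "1 + of_real (s / (2 * \<beta>)) * t = (1 + endpoint) /\<^sub>R 2"
    by (simp add: endpoint_def scaleR_conv_of_real field_simps)
  have e: "norm endpoint < 1" "\<And>v. v \<in> V \<Longrightarrow> norm (endpoint - v) < \<tau>" "Re (endpoint * cnj \<epsilon>) > \<rho> / 2"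
    using endpoint_good by (auto simp: good_def)
  have "norm ((1 + endpoint) /\<^sub>R 2) < 1"
    using e(1) by (intro norm_midpoint_less) auto
  moreover have "norm ((1 + endpoint) /\<^sub>R 2 - v) < \<tau>" if v: "v \<in> V" for v
  proof -
    have "norm ((1 - v + (endpoint - v)) /\<^sub>R 2) < \<tau>"
      using e(1) e(2)[OF v] dist_one_root_le[OF v] by (intro norm_midpoint_less) auto
    also have "(1 - v + (endpoint - v)) /\<^sub>R 2 = (1 + endpoint) /\<^sub>R 2 - v"
      by (simp add: scaleR_conv_of_real field_simps)
    finally show ?thesis .
  qed
  moreover have "Re ((1 + endpoint) /\<^sub>R 2 * cnj \<epsilon>) > \<rho> / 2"
  proof -
    have "Re ((1 + endpoint) /\<^sub>R 2 * cnj \<epsilon>) = (cos (pi / real k) + Re (endpoint * cnj \<epsilon>)) / 2"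
      by (simp add: field_simps)
    then show ?thesis
      using e(3) \<rho>_le basic_pos by simp
  qed
  ultimately show ?thesis
    unfolding q good_def by simp
qed

lemma R_at_top: "filterlim R at_top sequentially"
proof -
  have "filterlim (\<lambda>M. b / s + 2 * \<beta> / s * real M) at_top sequentially"
    using basic_pos
    by (intro filterlim_tendsto_add_at_top[OF tendsto_const]
        filterlim_tendsto_pos_mult_at_top[OF tendsto_const _ filterlim_real_sequentially]) auto
  also have "(\<lambda>M. b / s + 2 * \<beta> / s * real M) = R"
    by (simp add: R_def fun_eq_iff add_divide_distrib algebra_simps)
  finally show ?thesis .
qed

lemma ratio_tendsto: "(\<lambda>M. real M / R M) \<longlonglongrightarrow> s / (2 * \<beta>)"
proof -
  have "(\<lambda>M. (2 * \<beta> + b * inverse (real M)) / s) \<longlonglongrightarrow> (2 * \<beta> + b * 0) / s"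
    using basic_pos by (intro tendsto_intros lim_inverse_n) auto
  then have "(\<lambda>M. inverse ((2 * \<beta> + b * inverse (real M)) / s)) \<longlonglongrightarrow> inverse (2 * \<beta> / s)"
    using basic_pos by (intro tendsto_inverse) auto
  moreover have "\<forall>\<^sub>F M in sequentially. inverse ((2 * \<beta> + b * inverse (real M)) / s) = real M / R M"
    using eventually_gt_at_top[of 0]
  proof eventually_elim
    case (elim M)
    have "R M = real M * ((2 * \<beta> + b * inverse (real M)) / s)"
      using elim basic_pos(1) by (simp add: R_def field_simps)
    then show ?case
      using elim by (simp add: divide_inverse)
  qed
  ultimately have "(\<lambda>M. real M / R M) \<longlonglongrightarrow> inverse (2 * \<beta> / s)"
    by (rule Lim_transform_eventually)
  then show ?thesis
    by simp
qed

text \<open>\<open>c = 1\<close> locates the cluster and \<open>c = 2\<close> the far end; the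
  bounded offset \<open>w\<close> vanishes in the limit.\<close>

lemma tendsto_rescaled:
  "(\<lambda>M. (of_real (R M) + of_real (c * real M) * t + w) / of_real (R M)) \<longlonglongrightarrow> 1 + of_real (c * (s / (2 * \<beta>))) * t"
proof -
  have inv: "(\<lambda>M. inverse (R M)) \<longlonglongrightarrow> 0"
    using tendsto_inverse_0_at_top R_at_top by blast
  have "(\<lambda>M. 1 + of_real (c * (real M / R M)) * t + w * of_real (inverse (R M)))
      \<longlonglongrightarrow> 1 + of_real (c * (s / (2 * \<beta>))) * t + w * of_real 0"
    by (intro tendsto_intros ratio_tendsto inv)
  moreover have "\<forall>\<^sub>F M in sequentially. 1 + of_real (c * (real M / R M)) * t + w * of_real (inverse (R M))
      = (of_real (R M) + of_real (c * real M) * t + w) / of_real (R M)"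
    using filterlim_at_top_dense[THEN iffD1, OF R_at_top, rule_format, of 0]
  proof eventually_elim
    case (elim M)
    then show ?case
      by (simp add: field_simps)
  qed
  ultimately show ?thesis
    using Lim_transform_eventually by fastforce
qed

text \<open>The points whose quotient by \<open>R M\<close> lies in a convex neighbourhood of \<open>good\<close>.\<close>

definition region :: "nat \<Rightarrow> complex set" where
  "region M = {z. norm z \<le> R M \<and> (\<forall>v\<in>V. norm (z - of_real (R M) * v) \<le> \<tau> * R M) \<and>
     Re (z * cnj \<epsilon>) \<ge> \<rho> / 2 * R M}"

lemma region_of_good:
  assumes "R M > 0" "z / of_real (R M) \<in> good"
  shows "z \<in> region M"
proof -
  have z: "z = of_real (R M) * (z / of_real (R M))"
    using assms(1) by simp
  define y where "y = z / of_real (R M)"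
  have y: "norm y < 1" "\<And>v. v \<in> V \<Longrightarrow> norm (y - v) < \<tau>" "Re (y * cnj \<epsilon>) > \<rho> / 2"
    using assms(2) unfolding y_def[symmetric] good_def by blast+
  have zy: "z = of_real (R M) * y"
    using z by (simp add: y_def)
  have "norm z = R M * norm y"
    using assms(1) by (simp add: zy norm_mult)
  then have "norm z \<le> R M"
    using y(1) assms(1) mult_left_mono[of "norm y" 1 "R M"] by simp
  moreover have "norm (z - of_real (R M) * v) \<le> \<tau> * R M" if "v \<in> V" for v
  proof -
    have "z - of_real (R M) * v = of_real (R M) * (y - v)"
      by (simp add: zy algebra_simps)
    then have "norm (z - of_real (R M) * v) = R M * norm (y - v)"
      using assms(1) by (simp add: norm_mult)
    then show ?thesis
      using y(2)[OF that] assms(1) by (simp add: mult.commute)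
  qed
  moreover have "Re (z * cnj \<epsilon>) \<ge> \<rho> / 2 * R M"
  proof -
    have "Re (z * cnj \<epsilon>) = R M * Re (y * cnj \<epsilon>)"
      unfolding zy mult.assoc by (simp only: Re_complex_of_real times_complex.sel Im_complex_of_real)
    moreover have "R M * (\<rho> / 2) \<le> R M * Re (y * cnj \<epsilon>)"
      using y(3) assms(1) by (intro mult_left_mono) auto
    ultimately show ?thesis
      by (simp only: mult.commute)
  qed
  ultimately show ?thesis
    by (simp add: region_def)
qed

lemma convex_region: "convex (region M)"
proof -
  have "region M = cball 0 (R M) \<inter> (\<Inter>v\<in>V. cball (of_real (R M) * v) (\<tau> * R M)) \<inter> {z. inner \<epsilon> z \<ge> \<rho> / 2 * R M}"
    by (auto simp: region_def dist_norm norm_minus_commute inner_complex_def mult.commute)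
  also have "convex \<dots>"
    by (intro convex_Int convex_INT convex_cball convex_halfspace_ge)
  finally show ?thesis .
qed

lemma R_region: "R M > 0 \<Longrightarrow> of_real (R M) \<in> region M"
proof -
  assume R: "R M > 0"
  have "norm (of_real (R M) - of_real (R M) * v) \<le> \<tau> * R M" if "v \<in> V" for v
  proof -
    have "norm (of_real (R M) - of_real (R M) * v) = norm (of_real (R M) * (1 - v))"
      by (simp add: algebra_simps)
    also have "\<dots> = R M * norm (1 - v)"
      using R by (simp add: norm_mult)
    also have "\<dots> \<le> R M * \<tau>"
      using R dist_one_root_le[OF that] by (intro mult_left_mono) auto
    finally show ?thesis
      by (simp add: mult.commute)
  qed
  moreover have "\<rho> / 2 * R M \<le> cos (pi / real k) * R M"
    using R \<rho>_le basic_pos by (intro mult_right_mono) auto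
  ultimately show ?thesis
    using R by (simp add: region_def mult.commute)
qed

theorem ex_chamber_cells:
  obtains D\<^sub>0 r c where "chamber_cells k D\<^sub>0 r" "\<And>x. x \<in> Q \<Longrightarrow> c + x \<in> D\<^sub>0"
proof -
  have R_gt: "\<forall>\<^sub>F M in sequentially. R M > x" for x
    using filterlim_at_top_dense[THEN iffD1, OF R_at_top] by blast
  have large: "\<forall>\<^sub>F M in sequentially. real M * c + x > 1" if "c > 0" for c x
  proof -
    have "filterlim (\<lambda>M. x + c * real M) at_top sequentially"
      by (intro filterlim_tendsto_add_at_top[OF tendsto_const]
          filterlim_tendsto_pos_mult_at_top[OF tendsto_const that filterlim_real_sequentially])
    from filterlim_at_top_dense[THEN iffD1, OF this, rule_format, of 1] show ?thesis
      by (simp add: algebra_simps)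
  qed
  have tend: "(\<lambda>M. (of_real (R M) + of_nat M * t + x) / of_real (R M)) \<longlonglongrightarrow> 1 + of_real (s / (2 * \<beta>)) * t" for x
    using tendsto_rescaled[of 1 x] by simp
  have tend2: "(\<lambda>M. (of_real (R M) + 2 * of_nat M * t + \<delta>) / of_real (R M)) \<longlonglongrightarrow> endpoint"
    using tendsto_rescaled[of 2 \<delta>] by (simp add: endpoint_def)
  have "\<forall>\<^sub>F M in sequentially. R M > 0 \<and> R M > 4 / (\<rho> * s) \<and> M \<ge> 1
      \<and> (of_real (R M) + 2 * of_nat M * t + \<delta>) / of_real (R M) \<in> good
      \<and> (\<forall>x\<in>Q. (of_real (R M) + of_nat M * t + x) / of_real (R M) \<in> good
            \<and> real M * Im t + Im x > 1 \<and> real M * \<beta> + (b - Im (x * cnj \<epsilon>)) > 1)"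
    using finite_Q Im_t basic_pos
    by (intro eventually_conj R_gt eventually_ge_at_top eventually_ball_finite ballI large
        topological_tendstoD[OF tend2 open_good endpoint_good]
        topological_tendstoD[OF tend open_good quarter_good]) auto
  \<comment> \<open>The bound \<open>4 / (\<rho> * s)\<close> yields \<open>far\<close>, because
    points of \<open>region M\<close> have norm at least \<open>\<rho> / 2 * R M\<close>.
    Containment is asked of the cluster and of the far end; the arms follow by convexity. The last
    two conditions keep the cluster off both walls.\<close>
  then obtain M where M: "R M > 0" "R M > 4 / (\<rho> * s)" "M \<ge> 1"
    "(of_real (R M) + 2 * of_nat M * t + \<delta>) / of_real (R M) \<in> good"
    "\<And>x. x \<in> Q \<Longrightarrow> (of_real (R M) + of_nat M * t + x) / of_real (R M) \<in> good"
    "\<And>x. x \<in> Q \<Longrightarrow> real M * Im t + Im x > 1"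
    "\<And>x. x \<in> Q \<Longrightarrow> real M * \<beta> + (b - Im (x * cnj \<epsilon>)) > 1"
    by (auto dest: eventually_happens)
  \<comment> \<open>The cell \<open>0\<close> of the cluster sits \<open>M\<close> steps after the
    corner; the second arm has \<open>M\<close> steps as well.\<close>
  define c where "c = of_real (R M) + of_nat M * t"
  define D\<^sub>0 where "D\<^sub>0 = (+) c ` cells M"
  have cells_cases: "(\<exists>j\<le>M. x = - (of_nat j * t)) \<or> x \<in> Q \<or> (\<exists>j\<le>M. x = \<delta> + of_nat j * t)"
    if "x \<in> cells M" for x
    using that by (auto simp: cells_def before_def after_def)
  have c\<epsilon>: "Im (c * cnj \<epsilon>) = - (real M * \<beta> + b)"
  proof -
    have "R M * s = 2 * real M * \<beta> + b"
      using basic_pos(1) by (simp add: R_def)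
    moreover have "Im (c * cnj \<epsilon>) = - (R M * s) + real M * \<beta>"
    proof -
      have "c * cnj \<epsilon> = of_real (R M) * cnj \<epsilon> + of_real (real M) * (t * cnj \<epsilon>)"
        by (simp add: c_def algebra_simps)
      moreover have "Im (of_real r * z + of_real r' * z') = r * Im z + r' * Im z'" for r r' z z'
        by simp
      ultimately have "Im (c * cnj \<epsilon>) = R M * Im (cnj \<epsilon>) + real M * Im (t * cnj \<epsilon>)"
        by metis
      then show ?thesis
        unfolding \<beta>_def[symmetric] by (simp add: s_def)
    qed
    ultimately show ?thesis
      by simp
  qed
  have Im_add_mult: "Im ((z + of_nat j * t) * cnj \<epsilon>) = Im (z * cnj \<epsilon>) + real j * \<beta>" for z j
  proof -
    have "(z + of_nat j * t) * cnj \<epsilon> = z * cnj \<epsilon> + of_real (real j) * (t * cnj \<epsilon>)"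
      by (simp add: algebra_simps)
    moreover have "Im (w + of_real r * w') = Im w + r * Im w'" for w w' r
      by simp
    ultimately show ?thesis
      unfolding \<beta>_def by metis
  qed
  have reg_Q: "c + x \<in> region M" if "x \<in> Q" for x
    using region_of_good[OF M(1) M(5)[OF that]] by (simp add: c_def)
  have reg_end: "c + \<delta> + of_nat M * t \<in> region M"
    using region_of_good[OF M(1) M(4)] by (simp add: c_def algebra_simps)
  have segment: "z + of_nat j * w \<in> region M" if "z \<in> region M" "z + of_nat M * w \<in> region M" "j \<le> M" for z w j
  proof -
    have "(1 - real j / real M) *\<^sub>R z + (real j / real M) *\<^sub>R (z + of_nat M * w) \<in> region M"
      using that M(3) by (intro convexD[OF convex_region]) auto
    also have "(1 - real j / real M) *\<^sub>R z + (real j / real M) *\<^sub>R (z + of_nat M * w) = z + of_nat j * w"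
      using M(3) by (simp add: scaleR_conv_of_real field_simps)
    finally show ?thesis .
  qed
  have region: "c + x \<in> region M" if "x \<in> cells M" for x
    using cells_cases[OF that]
  proof (elim disjE exE conjE)
    fix j assume "j \<le> M" "x = - (of_nat j * t)"
    then show ?thesis
      using segment[of "c + 0" "- t" j] reg_Q[OF Q_0] R_region[OF M(1)] by (simp add: c_def)
  next
    fix j assume "j \<le> M" "x = \<delta> + of_nat j * t"
    then show ?thesis
      using segment[OF reg_Q[OF Q_\<delta>] reg_end] by (simp add: add.assoc)
  qed (rule reg_Q)
  have Im_1: "Im (c + x) = 0 \<or> Im (c + x) > 1" if "x \<in> cells M" for x
    using cells_cases[OF that]
  proof (elim disjE exE conjE)
    fix j assume j: "j \<le> M" "x = - (of_nat j * t)"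
    then have "Im (c + x) = real (M - j) * Im t"
      by (simp add: c_def of_nat_diff algebra_simps)
    \<comment> \<open>Every cell of the first arm other than the corner is at least one step above
      the wall, and a step is higher than 1.\<close>
    moreover have "real (M - j) * Im t \<ge> 1 * Im t" if "j \<noteq> M"
      using that j(1) Im_t by (intro mult_right_mono) auto
    ultimately show ?thesis
      using Im_t by (cases "j = M") (simp, linarith)
  next
    assume "x \<in> Q"
    then show ?thesis
      using M(6) by (simp add: c_def)
  next
    fix j assume "j \<le> M" "x = \<delta> + of_nat j * t"
    then have "Im (c + x) = real M * Im t + Im \<delta> + real j * Im t"
      by (simp add: c_def)
    moreover have "real j * Im t \<ge> 0"
      using Im_t by simp
    ultimately show ?thesis
      using M(6)[OF Q_\<delta>] by simp
  qed
  have Im_\<epsilon>: "Im ((c + x) * cnj \<epsilon>) = 0 \<or> Im ((c + x) * cnj \<epsilon>) < -1" if "x \<in> cells M" for x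
    using cells_cases[OF that]
  proof (elim disjE exE conjE)
    fix j assume j: "j \<le> M" "x = - (of_nat j * t)"
    have "Im (c * cnj \<epsilon>) = Im ((c + x) * cnj \<epsilon>) + real j * \<beta>"
      using Im_add_mult[of "c + x" j] j(2) by simp
    moreover have "real j * \<beta> \<ge> 0"
      using basic_pos by simp
    ultimately show ?thesis
      using M(7)[OF Q_0] c\<epsilon> by simp
  next
    assume x: "x \<in> Q"
    have "Im ((c + x) * cnj \<epsilon>) = Im (c * cnj \<epsilon>) + Im (x * cnj \<epsilon>)"
      unfolding distrib_right by simp
    then show ?thesis
      using M(7)[OF x] unfolding c\<epsilon> by linarith
  next
    fix j assume j: "j \<le> M" "x = \<delta> + of_nat j * t"
    have "Im ((c + \<delta>) * cnj \<epsilon>) = Im (c * cnj \<epsilon>) + Im (\<delta> * cnj \<epsilon>)"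
      unfolding distrib_right by simp
    then have "Im ((c + x) * cnj \<epsilon>) = - (real M * \<beta>) + real j * \<beta>"
      using Im_add_mult[of "c + \<delta>" j] unfolding c\<epsilon> b_def[symmetric] j(2) by (simp add: add.assoc)
    then have "Im ((c + x) * cnj \<epsilon>) = - (real (M - j) * \<beta>)"
      using j(1) by (simp add: of_nat_diff algebra_simps)
    moreover have "real (M - j) * \<beta> \<ge> 1 * \<beta>" if "j \<noteq> M"
      using that j(1) basic_pos by (intro mult_right_mono) auto
    ultimately show ?thesis
      using basic_pos by (cases "j = M") (simp, linarith)
  qed
  have R_eq: "of_real (R M) = c + - (of_nat M * t)"
    by (simp add: c_def)
  have translate: "(c + x, c + y) \<in> {(d, d') \<in> D\<^sub>0 \<times> D\<^sub>0. touching \<tau> V d d'}\<^sup>*"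
    if "(x, y) \<in> {(d, d') \<in> cells M \<times> cells M. touching \<tau> V d d'}\<^sup>*" for x y
    using that by (rule rtrancl_image) (auto simp: D\<^sub>0_def touching_def)
  have "chamber_cells k D\<^sub>0 (R M)"
  proof
    show "finite D\<^sub>0"
      using finite_Q by (simp add: D\<^sub>0_def cells_def before_def after_def)
    show "0 < R M"
      by (rule M(1))
    show "of_real (R M) \<in> D\<^sub>0"
      unfolding D\<^sub>0_def R_eq by (intro imageI) (auto simp: cells_def before_def)
    show "\<exists>z\<in>D\<^sub>0. Im (z * cnj \<epsilon>) = 0"
    proof
      have "\<delta> + of_nat M * t \<in> cells M"
        by (auto simp: cells_def after_def)
      then show "c + (\<delta> + of_nat M * t) \<in> D\<^sub>0"
        unfolding D\<^sub>0_def by (rule imageI)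
      have "Im ((c + \<delta>) * cnj \<epsilon>) = Im (c * cnj \<epsilon>) + Im (\<delta> * cnj \<epsilon>)"
        unfolding distrib_right by simp
      then show "Im ((c + (\<delta> + of_nat M * t)) * cnj \<epsilon>) = 0"
        using Im_add_mult[of "c + \<delta>" M] unfolding c\<epsilon> b_def[symmetric] add.assoc by simp
    qed
    fix z assume "z \<in> D\<^sub>0"
    then obtain x where x: "x \<in> cells M" "z = c + x"
      by (auto simp: D\<^sub>0_def)
    have z: "z \<in> region M"
      using region[OF x(1)] x(2) by simp
    show "Im z = 0 \<or> Im z > 1" "Im (z * cnj \<epsilon>) = 0 \<or> Im (z * cnj \<epsilon>) < -1"
      unfolding x(2) by (rule Im_1[OF x(1)], rule Im_\<epsilon>[OF x(1)])
    show "norm z \<le> R M" "\<And>v. v \<in> V \<Longrightarrow> norm (z - of_real (R M) * v) \<le> \<tau> * R M"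
      using z unfolding region_def by blast+
    show "2 < norm z * sin (pi / real k)"
    proof -
      have "\<rho> / 2 * R M \<le> Re (z * cnj \<epsilon>)"
        using z by (simp add: region_def)
      also have "\<dots> \<le> norm z"
        using complex_Re_le_cmod[of "z * cnj \<epsilon>"] by (simp add: norm_mult)
      finally have "\<rho> / 2 * R M * s \<le> norm z * s"
        using basic_pos by (intro mult_right_mono) auto
      moreover have "2 < \<rho> / 2 * R M * s"
        using M(2) basic_pos by (simp add: field_simps)
      ultimately show ?thesis
        by (simp add: s_def)
    qed
    show "(of_real (R M), z) \<in> {(d, d') \<in> D\<^sub>0 \<times> D\<^sub>0. touching \<tau> V d d'}\<^sup>*"
      unfolding R_eq x(2) by (rule translate[OF linked_cells[OF x(1)]])
    fix w assume "w \<in> D\<^sub>0" "z \<noteq> w"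
    then obtain y where y: "y \<in> cells M" "w = c + y"
      by (auto simp: D\<^sub>0_def)
    have "ok z w"
      using ok_cells[OF x(1) y(1)] ok_diff[of z w x y] by (simp add: x(2) y(2))
    then show "touching \<tau> V z w \<or> 2 < norm (z - w)"
      using \<open>z \<noteq> w\<close> by (simp add: ok_def)
  qed
  moreover have "c + x \<in> D\<^sub>0" if "x \<in> Q" for x
    unfolding D\<^sub>0_def using that by (intro imageI) (simp add: cells_def)
  ultimately show thesis
    by (rule that)
qed

end

section \<open>Rings of cells\<close>

lemma cis_chord: "cis (A + B) - cis (A - B) = Complex (- (2 * sin B * sin A)) (2 * sin B * cos A)"
  by (simp add: complex_eq_iff cos_add cos_diff sin_add sin_diff)

lemma cos_ge_of_le_quarter:
  assumes "0 \<le> A" "A \<le> pi / 4"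
  shows "(cos A)\<^sup>2 \<ge> 1 / 2" "cos A > 0"
proof -
  have "cos (pi / 4) \<le> cos A"
    using assms by (intro cos_monotone_0_pi_le) auto
  moreover have "cos (pi / 4) > 0"
    by (simp add: cos_45)
  ultimately show "cos A > 0"
    by linarith
  have "(cos (pi / 4))\<^sup>2 \<le> (cos A)\<^sup>2"
    using \<open>cos (pi / 4) \<le> cos A\<close> \<open>cos (pi / 4) > 0\<close> by (intro power_mono) auto
  then show "(cos A)\<^sup>2 \<ge> 1 / 2"
    by (simp add: cos_45 power_divide)
qed

text \<open>The cluster is a ring of \<open>p\<close> cells whose positions form a regular \<open>p\<close>-gon with sides of
  length \<open>\<tau>\<close>. Consecutive cells touch each other in opposite vertices, so their labellings differ
  by the rotation \<open>x / y\<close>, and the \<open>p\<close>-th power of this rotation is not the identity.\<close>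

locale ring_polygon = regular_polygon +
  fixes p :: nat
  assumes p_odd: "odd p" and p_ge_3: "p \<ge> 3" and p_dvd: "p dvd k" and p_less: "p < k"
begin

definition h :: nat where "h = k div 2"

text \<open>The smallest positive number of the parity of \<open>h\<close>. The parity makes
  \<open>x\<close> a vertex, \<open>c \<ge> 1\<close> gives \<open>A \<ge> pi / k\<close>, and
  smallness gives \<open>A \<le> pi / 4\<close>.\<close>

definition c :: nat where "c = (if even h then 2 else 1)"

text \<open>\<open>x\<close> and \<open>y\<close> are the vertices at the angles
  \<open>A + B\<close> and \<open>A - B\<close>, so \<open>t\<close> is a diametral chord that
  deviates from the vertical by \<open>A\<close>.\<close>

definition x :: complex where "x = vertex ((c + h) div 2)"

definition y :: complex where "y = x * cnj (vertex h)"

definition t :: complex where "t = x - y"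

lemma k_ge_6: "k \<ge> 6"
proof -
  obtain m where m: "k = p * m"
    using p_dvd by (elim dvdE)
  have "m \<noteq> 0" "m \<noteq> 1"
    using p_less m by auto
  then have "3 * 2 \<le> p * m"
    using p_ge_3 by (intro mult_le_mono) auto
  then show ?thesis
    using m by simp
qed

lemma c_bounds: "1 \<le> c" "4 * c \<le> k" "even (c + h)"
proof -
  have "h \<ge> 3"
    using k_ge_6 by (simp add: h_def)
  \<comment> \<open>With \<open>h\<close> even, \<open>c = 2\<close> requires
    \<open>k \<ge> 8\<close>; an even \<open>h \<ge> 3\<close> is at least 4.\<close>
  moreover have "h \<noteq> 3" if "even h"
    using that by auto
  moreover have "2 * h \<le> k"
    by (simp add: h_def)
  ultimately show "1 \<le> c" "4 * c \<le> k" "even (c + h)"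
    using k_ge_6 by (auto simp: c_def)
qed

abbreviation A :: real where "A \<equiv> pi * real c / real k"

abbreviation B :: real where "B \<equiv> pi * real h / real k"

lemma \<tau>_eq: "\<tau> = 2 * sin B"
  by (simp add: \<tau>_def h_def)

lemma x_eq: "x = cis (A + B)" and y_eq: "y = cis (A - B)"
proof -
  have "2 * ((c + h) div 2) = c + h"
    using c_bounds(3) by simp
  then have q: "2 * real ((c + h) div 2) = real c + real h"
    by linarith
  have "2 * pi * real ((c + h) div 2) / real k = pi * (2 * real ((c + h) div 2)) / real k"
    by (simp only: mult_ac)
  also have "\<dots> = A + B"
    unfolding q by (simp only: distrib_left add_divide_distrib)
  finally have "2 * pi * real ((c + h) div 2) / real k = A + B" .
  then show x: "x = cis (A + B)"
    by (simp only: x_def)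
  have "A + B + - (2 * pi * real h / real k) = A - B"
    by (simp add: field_simps)
  then show "y = cis (A - B)"
    by (simp only: y_def x cis_cnj cis_mult)
qed

lemma A_bounds: "0 \<le> A" "A \<le> pi / 4" "0 \<le> A - pi / real k" "A - pi / real k \<le> pi / 4"
proof -
  have k: "real k > 0"
    using k_ge_3 by simp
  have "4 * real c \<le> real k"
    using c_bounds(2) by linarith
  then show A: "A \<le> pi / 4"
    using k by (simp add: field_simps)
  show "0 \<le> A"
    by simp
  have "pi * 1 / real k \<le> A"
    using c_bounds(1) k by (intro divide_right_mono mult_left_mono) auto
  then show "0 \<le> A - pi / real k"
    by simp
  have "0 \<le> pi / real k"
    by simp
  then show "A - pi / real k \<le> pi / 4"
    using A by linarith
qed

lemma x_V: "x \<in> V" and y_V: "y \<in> V"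
  unfolding x_def y_def by (intro V_closed vertex_V)+

lemma norm_t_eq: "norm (x - y) = \<tau>"
  unfolding x_eq y_eq norm_diff_cis using \<tau>_eq \<tau>_sq(2) by simp

text \<open>The squares give \<open>3 * (1 / 2) > 1\<close>. This serves the distances from both
  walls and the diagonals of the ring.\<close>

lemma \<tau>_cos_gt_1:
  assumes "0 \<le> \<theta>" "\<theta> \<le> pi / 4"
  shows "\<tau> * cos \<theta> > 1"
proof -
  have "3 * (1 / 2) \<le> \<tau>\<^sup>2 * (cos \<theta>)\<^sup>2"
    using \<tau>_sq cos_ge_of_le_quarter[OF assms] by (intro mult_mono) auto
  then have "1\<^sup>2 < (\<tau> * cos \<theta>)\<^sup>2"
    by (simp add: power_mult_distrib)
  then show ?thesis
    by (rule power2_less_imp_less) (use \<tau>_sq cos_ge_of_le_quarter[OF assms] in simp)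
qed

lemma t_eq: "t = Complex (- (\<tau> * sin A)) (\<tau> * cos A)"
  unfolding t_def x_eq y_eq cis_chord \<tau>_eq ..

lemma t_\<epsilon>_eq: "t * cnj \<epsilon> = Complex (- (\<tau> * sin (A - pi / real k))) (\<tau> * cos (A - pi / real k))"
proof -
  have "t * cnj \<epsilon> = cis (A - pi / real k + B) - cis (A - pi / real k - B)"
    by (simp add: t_def x_eq y_eq left_diff_distrib cis_cnj cis_mult algebra_simps)
  then show ?thesis
    by (simp only: cis_chord \<tau>_eq)
qed

definition w :: complex where "w = cis (2 * pi / real p)"

definition W :: "complex set" where "W = {z. z ^ p = 1}"

text \<open>Placed so that the side from \<open>g\<close> to \<open>g * w\<close> of the
  \<open>p\<close>-gon \<open>g * W\<close> equals \<open>t\<close>; the side that starts at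
  \<open>g * v\<close> is then \<open>v * t\<close>.\<close>

definition g :: complex where "g = t / (w - 1)"

lemma W_eq: "W = (\<lambda>n. w ^ n) ` {..<p}"
proof -
  have "W = (\<lambda>n. cis (2 * pi * real n / real p)) ` {..<p}"
    using Complex.bij_betw_roots_unity[of p] p_ge_3 unfolding W_def bij_betw_def by simp
  also have "(\<lambda>n. cis (2 * pi * real n / real p)) = (\<lambda>n. w ^ n)"
    by (simp add: fun_eq_iff w_def Complex.DeMoivre mult.commute)
  finally show ?thesis .
qed

text \<open>Makes every side \<open>v * t = v * x - v * y\<close> of the ring a chord between
  vertices.\<close>

lemma W_subset_V: "W \<subseteq> V"
proof
  fix v assume v: "v \<in> W"
  obtain m where m: "k = p * m"
    using p_dvd by (elim dvdE)
  have "v ^ k = (v ^ p) ^ m"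
    by (simp add: m power_mult)
  then show "v \<in> V"
    using v by (simp add: W_def V_def)
qed

lemma w_W: "w \<in> W"
  unfolding W_eq by (rule image_eqI[of _ _ 1]) (use p_ge_3 in auto)

lemma one_W: "1 \<in> W"
  by (simp add: W_def)

lemma W_mult: "v \<in> W \<Longrightarrow> v' \<in> W \<Longrightarrow> v * v' \<in> W" and W_cnj: "v \<in> W \<Longrightarrow> cnj v \<in> W"
  by (auto simp: W_def power_mult_distrib simp flip: complex_cnj_power)

lemma W_power: "v \<in> W \<Longrightarrow> v * w ^ n \<in> W"
  using W_mult w_W one_W by (induction n) (auto simp: mult.assoc[symmetric] mult.commute[of w])

lemma W_cases:
  assumes "v \<in> W" "v' \<in> W"
  obtains n where "n < p" "v' = v * w ^ n"
proof -
  have "cnj v * v' \<in> W"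
    using assms W_cnj W_mult by blast
  then obtain n where "n < p" "cnj v * v' = w ^ n"
    unfolding W_eq by auto
  then have "v * w ^ n = (v * cnj v) * v'"
    by (simp only: mult.assoc)
  also have "v * cnj v = 1"
    using V_cnj_mult(1) assms(1) W_subset_V by blast
  finally show thesis
    using that[OF \<open>n < p\<close>] by simp
qed

lemma sin_p_pos: "sin (pi / real p) > 0"
  using p_ge_3 by (intro sin_gt_zero) (auto simp: field_simps)

lemma norm_w_power: "norm (1 - w ^ n) = 2 * \<bar>sin (pi * real n / real p)\<bar>"
proof -
  have "norm (1 - w ^ n) = norm (cis 0 - cis (real n * (2 * pi / real p)))"
    by (simp add: w_def Complex.DeMoivre)
  also have "\<dots> = 2 * \<bar>sin (- (pi * real n / real p))\<bar>"
    unfolding norm_diff_cis by (simp add: field_simps)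
  finally show ?thesis
    by simp
qed

lemma w_ne_1: "w \<noteq> 1"
  using norm_w_power[of 1] sin_p_pos by auto

lemma g_mult: "g * (w - 1) = t"
  using w_ne_1 by (simp add: g_def)

lemma touching_next:
  assumes "v \<in> W"
  shows "touching \<tau> V (g * v) (g * (v * w))"
proof -
  have "touching \<tau> V (v * x) (v * y)"
    using touching_mult[of v x y] x_V y_V norm_t_eq W_subset_V assms by (auto simp: touching_def)
  moreover have "v * x - v * y = g * (v * w) - g * v"
  proof -
    have "v * x - v * y = v * (g * (w - 1))"
      unfolding g_mult by (simp add: t_def algebra_simps)
    then show ?thesis
      by (simp add: algebra_simps)
  qed
  ultimately have "touching \<tau> V (g * (v * w)) (g * v)"
    using touching_diff by metis
  then show ?thesis
    by (rule touching_sym)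
qed

lemma sin_nonadjacent_ge:
  assumes "2 \<le> n" "n + 2 \<le> p"
  shows "sin (pi * real n / real p) \<ge> sin (2 * (pi / real p))"
proof -
  have le: "sin (2 * (pi / real p)) \<le> sin (pi * real m / real p)" if m: "2 \<le> m" "2 * m \<le> p" for m
  proof (rule sin_monotone_2pi_le)
    have "2 * real m \<le> real p"
      using m(2) by linarith
    then have "pi * (2 * real m) \<le> pi * real p"
      by simp
    then show "pi * real m / real p \<le> pi / 2"
      using p_ge_3 by (simp add: field_simps)
    have "pi * 2 / real p \<le> pi * real m / real p"
      using m(1) by (intro divide_right_mono mult_left_mono) auto
    then show "2 * (pi / real p) \<le> pi * real m / real p"
      by (simp add: mult.commute)
    have "0 \<le> 2 * (pi / real p)"
      by simp
    then show "- (pi / 2) \<le> 2 * (pi / real p)"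
      using pi_gt_zero by linarith
  qed
  show ?thesis
  proof (cases "2 * n \<le> p")
    case False
    have "sin (pi * real n / real p) = sin (pi - pi * real n / real p)"
      by simp
    also have "pi - pi * real n / real p = pi * real (p - n) / real p"
      using assms p_ge_3 by (simp add: of_nat_diff field_simps)
    finally show ?thesis
      using le[of "p - n"] False assms by simp
  qed (use le assms in simp)
qed

text \<open>The shortest diagonal of a regular \<open>p\<close>-gon with side \<open>\<tau>\<close>
  has length \<open>2 * \<tau> * cos (pi / p)\<close>.\<close>

lemma nonadjacent_far:
  assumes "v \<in> W" "2 \<le> n" "n + 2 \<le> p"
  shows "norm (g * v - g * (v * w ^ n)) > 2"
proof -
  have v: "norm v = 1"
    using assms(1) W_subset_V V_norm by blast
  have "norm g = \<tau> / norm (1 - w ^ 1)"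
    unfolding g_def norm_divide t_def norm_t_eq by (simp add: norm_minus_commute)
  also have "\<dots> = \<tau> / (2 * sin (pi / real p))"
    unfolding norm_w_power using sin_p_pos by simp
  finally have norm_g: "norm g = \<tau> / (2 * sin (pi / real p))" .
  have "g * v - g * (v * w ^ n) = g * v * (1 - w ^ n)"
    by (simp add: algebra_simps)
  then have "norm (g * v - g * (v * w ^ n)) = \<tau> / sin (pi / real p) * \<bar>sin (pi * real n / real p)\<bar>"
    by (simp add: norm_mult v norm_g norm_w_power)
  moreover have "\<tau> / sin (pi / real p) * sin (2 * (pi / real p))
      \<le> \<tau> / sin (pi / real p) * \<bar>sin (pi * real n / real p)\<bar>"
    using sin_nonadjacent_ge[OF assms(2,3)] sin_p_pos \<tau>_sq(2) by (intro mult_left_mono) auto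
  moreover have "\<tau> / sin (pi / real p) * sin (2 * (pi / real p)) = 2 * (\<tau> * cos (pi / real p))"
    unfolding sin_double using sin_p_pos by (simp add: field_simps)
  moreover have "\<tau> * cos (pi / real p) > 1"
    \<comment> \<open>The bounds on \<open>n\<close> force \<open>p \<ge> 4\<close>, hence
      \<open>pi / p \<le> pi / 4\<close>; a triangle has no diagonals.\<close>
    using assms(2,3) by (intro \<tau>_cos_gt_1) (simp_all add: field_simps)
  ultimately show ?thesis
    by linarith
qed

lemma ok_ring:
  assumes "v \<in> W" "v' \<in> W"
  shows "ok (g * v) (g * v')"
proof -
  obtain n where n: "n < p" "v' = v * w ^ n"
    using W_cases[OF assms] by blast
  consider "n = 0" | "n = 1" | "n = p - 1" | "2 \<le> n" "n + 2 \<le> p"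
    using n(1) by linarith
  then show ?thesis
  proof cases
    case 1
    then show ?thesis
      by (simp add: n(2) ok_def)
  next
    case 2
    then show ?thesis
      using touching_next[OF assms(1)] by (simp add: n(2) ok_def)
  next
    case 3
    have "w ^ n * w = w ^ p"
      using 3 p_ge_3 by (simp flip: power_Suc2)
    also have "\<dots> = 1"
      using w_W by (simp add: W_def)
    finally have "v' * w = v"
      by (simp add: n(2) mult.assoc)
    then show ?thesis
      using touching_sym[OF touching_next[OF assms(2)]] by (simp add: ok_def)
  next
    case 4
    then show ?thesis
      using nonadjacent_far[OF assms(1)] by (simp add: n(2) ok_def)
  qed
qed

text \<open>For even \<open>k\<close> the vertex is -1 and \<open>p\<close> is odd. For odd
  \<open>k\<close> we have \<open>2 * h + 1 = k\<close>, so \<open>vertex h ^ p = 1\<close> would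
  entail \<open>vertex 1 ^ p = 1\<close>, which contradicts \<open>0 < p < k\<close>.\<close>

lemma vertex_h_power: "vertex h ^ p \<noteq> 1"
proof
  assume one: "vertex h ^ p = 1"
  show False
  proof (cases "even k")
    case True
    then have "2 * real h = real k"
      by (auto simp: h_def elim: evenE)
    then have "2 * pi * real h / real k = pi"
      using k_ge_3 by (simp add: field_simps)
    then have "vertex h = - 1"
      by (simp only: cis_pi)
    then show False
      using one p_odd by simp
  next
    case False
    then have "2 * h + 1 = k"
      by (auto simp: h_def elim: oddE)
    then have hk: "2 * real h + 1 = real k"
      by linarith
    have "2 * pi * real h / real k + 2 * pi * real h / real k + 2 * pi / real k
        = 2 * pi * (2 * real h + 1) / real k"
      by (simp add: add_divide_distrib algebra_simps)
    also have "\<dots> = 2 * pi"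
      unfolding hk using k_ge_3 by simp
    finally have "vertex h * vertex h * vertex 1 = 1"
      by (simp add: cis_mult)
    then have "(vertex h * vertex h * vertex 1) ^ p = 1"
      by simp
    then have "vertex 1 ^ p = 1"
      using one by (simp only: power_mult_distrib mult_1_left)
    then have "vertex p = vertex 0"
      unfolding Complex.DeMoivre by (simp add: mult.commute)
    moreover have "inj_on vertex {..<k}"
      using Complex.bij_betw_roots_unity[of k] k_ge_3 by (auto simp: bij_betw_def)
    ultimately have "p = 0"
      using p_less k_ge_3 inj_onD[of vertex "{..<k}" p 0] by simp
    then show False
      using p_ge_3 by simp
  qed
qed

lemma finite_W: "finite W"
  unfolding W_eq by simp

theorem ex_snf_without_GLP:
  "\<exists>N L \<nu>. simple_nested_fractal N L \<nu> \<and> card (essential_fixed_points N L \<nu>) = k \<and> \<not> GLP N L \<nu>"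
proof -
  have ne: "W \<noteq> {}"
    using one_W by blast
  obtain v\<^sub>0 where v0: "v\<^sub>0 \<in> W" "\<And>v. v \<in> W \<Longrightarrow> (g * v\<^sub>0) \<bullet> t \<le> (g * v) \<bullet> t"
    using ex_is_arg_min_if_finite[OF finite_W ne, of "\<lambda>v. (g * v) \<bullet> t"]
    unfolding is_arg_min_linorder by blast
  obtain v\<^sub>1 where v1: "v\<^sub>1 \<in> W" "\<And>v. v \<in> W \<Longrightarrow> - ((g * v\<^sub>1) \<bullet> t) \<le> - ((g * v) \<bullet> t)"
    using ex_is_arg_min_if_finite[OF finite_W ne, of "\<lambda>v. - ((g * v) \<bullet> t)"]
    unfolding is_arg_min_linorder by blast
  \<comment> \<open>The arms attach to the ring at its extreme cells in the direction
    \<open>t\<close>, given by \<open>v\<^sub>0\<close> and \<open>v\<^sub>1\<close>; the shift puts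
    the first of them at \<open>0\<close>.\<close>
  define q where "q v = g * v - g * v\<^sub>0" for v
  have diff: "q v - q v' = g * v - g * v'" for v v'
    by (simp add: q_def)
  have touch: "touching \<tau> V (q v) (q (v * w))" if "v \<in> W" for v
    using touching_diff[OF diff] touching_next[OF that] by blast
  interpret interrupted_chain k t "q v\<^sub>1" "q ` W"
  proof
    show "touching \<tau> V t 0"
      unfolding touching_def using x_V y_V norm_t_eq by (auto simp: t_def)
    show "Im t > 1" "Im (t * cnj \<epsilon>) > 1"
      unfolding t_\<epsilon>_eq unfolding t_eq using A_bounds by (simp_all add: \<tau>_cos_gt_1)
    have "0 \<le> sin (A - pi / real k)"
      using A_bounds pi_gt_zero by (intro sin_ge_zero) linarith+
    then show "Re (t * cnj \<epsilon>) \<le> 0"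
      unfolding t_\<epsilon>_eq using \<tau>_sq(2) by simp
    show "finite (q ` W)" "q v\<^sub>1 \<in> q ` W"
      using finite_W v1 by auto
    show "0 \<in> q ` W"
      using v0(1) by (auto simp: q_def intro!: image_eqI[of _ _ v\<^sub>0])
    show "ok z z'" if "z \<in> q ` W" "z' \<in> q ` W" for z z'
      using that ok_ring ok_diff[OF diff] by auto
    show "0 \<le> z \<bullet> t" "0 \<le> (q v\<^sub>1 - z) \<bullet> t" if "z \<in> q ` W" for z
      using that v0(2) v1(2) by (auto simp: q_def inner_diff_left)
    show "(0, z) \<in> {(d, d') \<in> q ` W \<times> q ` W. touching \<tau> V d d'}\<^sup>*" if z: "z \<in> q ` W" for z
    proof -
      obtain v where v: "v \<in> W" "z = q v"
        using z by blast
      obtain n where n: "v = v\<^sub>0 * w ^ n"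
        using W_cases[OF v0(1) v(1)] by blast
      have "(0, q (v\<^sub>0 * w ^ n)) \<in> {(d, d') \<in> q ` W \<times> q ` W. touching \<tau> V d d'}\<^sup>*" for n
      proof (induction n)
        case (Suc n)
        have "v\<^sub>0 * w ^ Suc n = v\<^sub>0 * w ^ n * w"
          by (simp add: mult_ac)
        then have "touching \<tau> V (q (v\<^sub>0 * w ^ n)) (q (v\<^sub>0 * w ^ Suc n))"
          using touch[OF W_power[OF v0(1)], of n] by (simp only:)
        then have "(q (v\<^sub>0 * w ^ n), q (v\<^sub>0 * w ^ Suc n)) \<in> {(d, d') \<in> q ` W \<times> q ` W. touching \<tau> V d d'}"
          by (intro CollectI case_prodI conjI SigmaI imageI W_power v0(1))
        with Suc.IH show ?case
          by (rule rtrancl_into_rtrancl)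
      qed (simp add: q_def)
      then show ?thesis
        unfolding v(2) n .
    qed
  qed
  obtain D\<^sub>0 r b where D0: "chamber_cells k D\<^sub>0 r" "\<And>z. z \<in> q ` W \<Longrightarrow> b + z \<in> D\<^sub>0"
    using ex_chamber_cells by blast
  interpret C: chamber_cells k D\<^sub>0 r
    by (rule D0(1))
  have mem: "b + q v \<in> C.D" if "v \<in> W" for v
    using C.D_I(1)[OF V_closed(1)] D0(2) that by force
  have no_labels: False
    if \<zeta>: "\<And>d. d \<in> C.D \<Longrightarrow> \<zeta> d \<noteq> 0"
      "\<And>d d' z z'. \<lbrakk>d \<in> C.D; d' \<in> C.D; z \<in> V; z' \<in> V; d + z = d' + z'\<rbrakk> \<Longrightarrow> \<zeta> d * z = \<zeta> d' * z'"
    for \<zeta> :: "complex \<Rightarrow> complex"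
  proof -
    \<comment> \<open>Neighbouring cells of the ring share the point that is the vertex
      \<open>v * x\<close> of the first and \<open>v * y\<close> of the second. The factor
      \<open>v\<close> cancels, so the quotient \<open>x / y = vertex h\<close> is the same all
      around.\<close>
    have step: "\<zeta> (b + q (v * w)) = \<zeta> (b + q v) * vertex h" if v: "v \<in> W" for v
    proof -
      have vV: "v \<in> V" "v * w \<in> W"
        using v W_subset_V W_mult w_W by auto
      have "q (v * w) - q v = v * (g * (w - 1))"
        by (simp add: q_def algebra_simps)
      also have "\<dots> = v * x - v * y"
        unfolding g_mult by (simp add: t_def algebra_simps)
      finally have "b + q (v * w) + v * y = b + q v + v * x"
        by (simp add: algebra_simps)
      then have "\<zeta> (b + q (v * w)) * (v * y) = \<zeta> (b + q v) * (v * x)"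
        using \<zeta>(2) mem v vV x_V y_V V_closed(2) by blast
      also have "x = y * vertex h"
        unfolding y_def using V_cnj_mult(2)[OF vertex_V[of h]] by (simp only: mult.assoc mult_1_right)
      finally have "(\<zeta> (b + q (v * w)) - \<zeta> (b + q v) * vertex h) * (v * y) = 0"
        by (simp add: algebra_simps)
      moreover have "v * y \<noteq> 0"
        using V_norm vV(1) y_V by fastforce
      ultimately show ?thesis
        by simp
    qed
    have "\<zeta> (b + q (w ^ n)) = \<zeta> (b + q 1) * vertex h ^ n" for n
    proof (induction n)
      case (Suc n)
      have "\<zeta> (b + q (w ^ n * w)) = \<zeta> (b + q (w ^ n)) * vertex h"
        using step W_power[OF one_W, of n] by simp
      then show ?case
        unfolding power_Suc2 Suc.IH by (simp only: mult.assoc)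
    qed simp
    \<comment> \<open>The ring closes after \<open>p\<close> steps, as
      \<open>w ^ p = 1\<close>.\<close>
    from this[of p] have "\<zeta> (b + q 1) = \<zeta> (b + q 1) * vertex h ^ p"
      using w_W by (simp add: W_def)
    then show False
      using vertex_h_power \<zeta>(1)[OF mem[OF one_W]] by simp
  qed
  show ?thesis
    using snf_without_GLP[OF C.pattern sum_V no_labels] unfolding card_V_eq .
qed

end

lemma odd_prime_factor:
  fixes k :: nat
  assumes "k > 0" "\<nexists>n. k = 2 ^ n"
  obtains p where "prime p" "odd p" "p dvd k"
proof -
  obtain m where m: "k = 2 ^ multiplicity 2 k * m" "odd m"
    using multiplicity_decompose'[of k 2] assms(1) by auto
  then have "m \<noteq> 1"
    using assms(2) by (metis mult.right_neutral)
  then obtain p where p: "prime p" "p dvd m"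
    using prime_factor_nat by blast
  show thesis
  proof (rule that[OF p(1)])
    show "odd p"
      using p(2) m(2) dvd_trans by blast
    show "p dvd k"
      using p(2) m(1) by (metis dvd_mult)
  qed
qed

theorem theorem3p5:
  fixes k :: nat
  assumes "k > 1" and "\<not> prime k" and "\<nexists>n. k = 2 ^ n"
  shows "\<exists>(N::nat) (L::real) (\<nu> :: nat \<Rightarrow> real ^ 2).
           simple_nested_fractal N L \<nu> \<and>
           card (essential_fixed_points N L \<nu>) = k \<and>
           \<not> GLP N L \<nu>"
proof -
  obtain p where p: "prime p" "odd p" "p dvd k"
    using odd_prime_factor[of k] assms(1,3) by auto
  have "p \<noteq> k"
    using p(1) assms(2) by blast
  then have "p < k"
    using dvd_imp_le[OF p(3)] assms(1) by linarith
  moreover have "p \<ge> 3"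
    using prime_ge_2_nat[OF p(1)] p(2) by (cases "p = 2") auto
  ultimately interpret ring_polygon k p
    by unfold_locales (use p in auto)
  show ?thesis
    by (rule ex_snf_without_GLP)
qed

end
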